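(* There is a polynomial-time algorithm to decide whether a given finite tree is a core.
   Context: A digraph is a pair $\mathbb{H}=(H;E)$ with $H$ a nonempty finite set and $E\subseteq H^2$. A homomorphism from a digraph $\mathbb{G}$ to a digraph $\mathbb{H}$ is a map $h\colon G\to H$ such that $(h(x),h(y))\in E(\mathbb{H})$ for every $(x,y)\in E(\mathbb{G})$. An endomorphism of $\mathbb{H}$ is a homomorphism from $\mathbb{H}$ to $\mathbb{H}$. A finite digraph is a core if all its endomorphisms are injective. An orientation of an undirected graph is obtained by replacing each edge $\{x,y\}$ by exactly one of $(x,y)$, $(y,x)$. A "tree" means a digraph that is an orientation of a finite undirected tree (connected acyclic graph). *)

theory Defs
  imports
    "Graph_Theory.Graph_Theory"
    "HOL-Computational_Algebra.Polynomial"
begin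

section \<open>Homomorphisms and cores\<close>

definition digraph_hom :: "'a pair_pre_digraph \<Rightarrow> 'b pair_pre_digraph \<Rightarrow> ('a \<Rightarrow> 'b) \<Rightarrow> bool" where
  "digraph_hom G H h \<longleftrightarrow>
     (\<forall>x \<in> pverts G. h x \<in> pverts H) \<and>
     (\<forall>x y. (x, y) \<in> parcs G \<longrightarrow> (h x, h y) \<in> parcs H)"

definition is_core :: "'a pair_pre_digraph \<Rightarrow> bool" where
  "is_core G \<longleftrightarrow> (\<forall>h. digraph_hom G G h \<longrightarrow> inj_on h (pverts G))"


section \<open>Oriented trees\<close>

text \<open>
  An undirected graph is a \<^locale>\<open>pair_graph\<close>: a finite symmetric loop-free digraph.  There
  every edge yields a directed cycle \<open>u, v, u\<close> of length 2, which does not count as a cycle of the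
  undirected graph; the undirected cycles are the directed cycles of length at least 3.
  The library predicate \<open>tree\<close> cannot be used: it forbids the 2-cycles, and applied to
  the oriented graph itself it forbids only directed cycles.
  Connectedness includes nonemptiness.
\<close>

definition undirected_tree :: "'a pair_pre_digraph \<Rightarrow> bool" where
  "undirected_tree G \<longleftrightarrow>
     pair_graph G \<and> Digraph_Component.connected (with_proj G) \<and>
     \<not> (\<exists>p. pre_digraph.cycle (with_proj G) p \<and> 3 \<le> length p)"

definition orientation_of :: "'a pair_pre_digraph \<Rightarrow> 'a pair_pre_digraph \<Rightarrow> bool" where
  "orientation_of T G \<longleftrightarrow>
     pverts T = pverts G \<and> parcs T \<subseteq> parcs G \<and>
     (\<forall>(x, y) \<in> parcs G. ((x, y) \<in> parcs T) \<noteq> ((y, x) \<in> parcs T))"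

definition oriented_tree :: "'a pair_pre_digraph \<Rightarrow> bool" where
  "oriented_tree T \<longleftrightarrow> (\<exists>G. undirected_tree G \<and> orientation_of T G)"


section \<open>Polynomial-time computation\<close>

text \<open>
  Random access machines with indirect addressing and unit cost, in the style of Cook and Reckhow,
  with a read-only binary input.  The arithmetic operations are addition and truncated subtraction;
  there is no multiplication, so the maximal bit length of a register grows by at most one per step
  (beyond a bound depending on the program and the input length).  Hence polynomial time on these
  machines coincides with polynomial time on Turing machines.
\<close>

datatype instr =
    LoadConst nat nat
  | Add nat nat nat
  | Sub nat nat nat
  | Load nat nat
  | Store nat nat
  | ReadInput nat nat
  | Jump nat
  | JumpZero nat nat

type_synonym ram_config = "nat \<times> (nat \<Rightarrow> nat)"

fun exec_instr :: "bool list \<Rightarrow> instr \<Rightarrow> ram_config \<Rightarrow> ram_config" where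
  "exec_instr w (LoadConst a k) (pc, R) = (Suc pc, R(a := k))"
| "exec_instr w (Add a b c) (pc, R) = (Suc pc, R(a := R b + R c))"
| "exec_instr w (Sub a b c) (pc, R) = (Suc pc, R(a := R b - R c))"
| "exec_instr w (Load a b) (pc, R) = (Suc pc, R(a := R (R b)))"
| "exec_instr w (Store a b) (pc, R) = (Suc pc, R(R a := R b))"
| "exec_instr w (ReadInput a b) (pc, R) =
     (Suc pc, R(a := if R b < length w \<and> w ! R b then 1 else 0))"
| "exec_instr w (Jump l) (pc, R) = (l, R)"
| "exec_instr w (JumpZero a l) (pc, R) = (if R a = 0 then l else Suc pc, R)"

definition ram_halted :: "instr list \<Rightarrow> ram_config \<Rightarrow> bool" where
  "ram_halted M c \<longleftrightarrow> length M \<le> fst c"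

definition ram_step :: "instr list \<Rightarrow> bool list \<Rightarrow> ram_config \<Rightarrow> ram_config" where
  "ram_step M w c = (if ram_halted M c then c else exec_instr w (M ! fst c) c)"

text \<open>Register 0 initially holds the input length; all other registers are 0.\<close>

definition ram_init :: "bool list \<Rightarrow> ram_config" where
  "ram_init w = (0, (\<lambda>_. 0)(0 := length w))"

definition ram_run :: "instr list \<Rightarrow> bool list \<Rightarrow> nat \<Rightarrow> ram_config" where
  "ram_run M w t = (ram_step M w ^^ t) (ram_init w)"

text \<open>The machine answers yes (no) by halting with 1 (0) in register 0.\<close>

definition ram_answers_within :: "instr list \<Rightarrow> bool list \<Rightarrow> nat \<Rightarrow> bool \<Rightarrow> bool" where
  "ram_answers_within M w t b \<longleftrightarrow>
     ram_halted M (ram_run M w t) \<and> snd (ram_run M w t) 0 = (if b then 1 else 0)"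

text \<open>
  The problem of deciding \<open>P\<close> for a given instance in \<open>D\<close>, where \<open>enc x w\<close> says that the word \<open>w\<close>
  encodes the instance \<open>x\<close> (which may have several encodings).
\<close>

definition poly_time_decidable ::
    "('i \<Rightarrow> bool list \<Rightarrow> bool) \<Rightarrow> 'i set \<Rightarrow> ('i \<Rightarrow> bool) \<Rightarrow> bool" where
  "poly_time_decidable enc D P \<longleftrightarrow>
     (\<exists>(M :: instr list) (p :: nat poly). \<forall>x \<in> D. \<forall>w. enc x w \<longrightarrow>
        ram_answers_within M w (poly p (length w)) (P x))"

text \<open>Row-by-row adjacency matrix with respect to an arbitrary enumeration of the vertices.\<close>

definition adjacency_encoding :: "'a pair_pre_digraph \<Rightarrow> bool list \<Rightarrow> bool" where
  "adjacency_encoding G w \<longleftrightarrow>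
     (\<exists>vs. distinct vs \<and> set vs = pverts G \<and> w = [(u, v) \<in> parcs G. u \<leftarrow> vs, v \<leftarrow> vs])"

end

theory Submission
  imports Defs
begin

text \<open>
  Let \<open>T\<close> be an oriented tree with \<open>n\<close> vertices.  It is not a core iff some endomorphism maps two
  distinct vertices \<open>u, v\<close> to the same vertex \<open>a\<close>.  For each of the \<open>n\<^sup>3\<close> choices of \<open>u, v, a\<close> the
  existence of such an endomorphism is decided by arc consistency: start with the lists \<open>{a}\<close> for
  \<open>u\<close> and \<open>v\<close> and all vertices for the others, and delete \<open>b\<close> from the list of \<open>x\<close> as long as some
  \<open>y\<close> has no candidate compatible with \<open>x \<mapsto> b\<close>.  An endomorphism of the required kind survives the
  deletions.  Conversely, if the final lists are nonempty, they contain the graph of an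
  endomorphism, because \<open>T\<close> has no cycles: a set of vertices of \<open>T\<close> contains one with at most one
  neighbour in the set, and a partial solution on the remaining vertices extends to it.
\<close>

section \<open>A loop language and its compilation\<close>

text \<open>
  A store consists of variables and of a separate memory.  Loops run over \<open>i = 0, \<dots>, m - 1\<close> for
  the value of a variable \<open>m\<close> that the body leaves unchanged, so every program terminates and its
  running time is bounded by a polynomial in the loop bounds.
\<close>

type_synonym store = "(nat \<Rightarrow> nat) \<times> (nat \<Rightarrow> nat)"

datatype aexp =
    Num nat
  | Var nat
  | Plus aexp aexp
  | Minus aexp aexp
  | Mem aexp
  | Inp aexp

datatype com =
    Assign nat aexp
  | Put aexp aexp
  | Seq com com (infixr \<open>;;\<close> 60)
  | For nat nat com

fun aval :: "bool list \<Rightarrow> aexp \<Rightarrow> store \<Rightarrow> nat" where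
  "aval w (Num k) s = k"
| "aval w (Var v) s = fst s v"
| "aval w (Plus a b) s = aval w a s + aval w b s"
| "aval w (Minus a b) s = aval w a s - aval w b s"
| "aval w (Mem a) s = snd s (aval w a s)"
| "aval w (Inp a) s = (if aval w a s < length w \<and> w ! aval w a s then 1 else 0)"

definition setv :: "nat \<Rightarrow> nat \<Rightarrow> store \<Rightarrow> store" where
  "setv v k s = ((fst s)(v := k), snd s)"

definition setm :: "nat \<Rightarrow> nat \<Rightarrow> store \<Rightarrow> store" where
  "setm p k s = (fst s, (snd s)(p := k))"

lemma fst_setv [simp]: "fst (setv v k s) = (fst s)(v := k)"
  and snd_setv [simp]: "snd (setv v k s) = snd s"
  and fst_setm [simp]: "fst (setm p k s) = fst s"
  and snd_setm [simp]: "snd (setm p k s) = (snd s)(p := k)"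
  by (simp_all add: setv_def setm_def)

text \<open>The number of rounds is the value of \<open>m\<close> on entry, whereas compiled code
  compares \<open>i\<close> with \<open>m\<close> in every round. The two agree when the body
  changes neither, which the hypotheses of \<open>compc_correct\<close> ensure.\<close>

fun sem :: "bool list \<Rightarrow> com \<Rightarrow> store \<Rightarrow> store" where
  "sem w (Assign v a) s = setv v (aval w a s) s"
| "sem w (Put a b) s = setm (aval w a s) (aval w b s) s"
| "sem w (c ;; d) s = sem w d (sem w c s)"
| "sem w (For i m c) s =
     ((\<lambda>s. let s' = sem w c s in setv i (Suc (fst s' i)) s') ^^ fst s m) (setv i 0 s)"

fun assigned :: "com \<Rightarrow> nat set" where
  "assigned (Assign v a) = {v}"
| "assigned (Put a b) = {}"
| "assigned (c ;; d) = assigned c \<union> assigned d"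
| "assigned (For i m c) = insert i (assigned c)"

fun bounds :: "com \<Rightarrow> nat set" where
  "bounds (Assign v a) = {}"
| "bounds (Put a b) = {}"
| "bounds (c ;; d) = bounds c \<union> bounds d"
| "bounds (For i m c) = insert m (bounds c)"

lemma sem_frame: "v \<notin> assigned c \<Longrightarrow> fst (sem w c s) v = fst s v"
proof (induction c arbitrary: s)
  case (For i m c)
  have "fst (((\<lambda>s. let s' = sem w c s in setv i (Suc (fst s' i)) s') ^^ k) s') v = fst s' v"
    for k s'
    using For by (induction k) (auto simp: Let_def)
  then show ?case using For.prems by simp
qed auto

text \<open>Beside the invariant, the induction carries the value of the counter and the fact that
  variables other than \<open>i\<close> not assigned by the body are as before the loop, so that
  invariants need not repeat this.\<close>

lemma For_rule:
  assumes "i \<notin> assigned c" "m \<notin> assigned c" "m \<noteq> i" and N: "fst s m = N"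
    and init: "P 0 (setv i 0 s)"
    and step: "\<And>k s'. k < N \<Longrightarrow> fst s' i = k \<Longrightarrow>
      (\<And>v. v \<notin> assigned c \<Longrightarrow> v \<noteq> i \<Longrightarrow> fst s' v = fst s v) \<Longrightarrow> P k s' \<Longrightarrow>
      P (Suc k) (setv i (Suc k) (sem w c s'))"
  shows "P N (sem w (For i m c) s)"
proof -
  define f where "f = (\<lambda>s. let s' = sem w c s in setv i (Suc (fst s' i)) s')"
  have "P k ((f ^^ k) (setv i 0 s)) \<and> fst ((f ^^ k) (setv i 0 s)) i = k \<and>
     (\<forall>v. v \<notin> assigned c \<longrightarrow> v \<noteq> i \<longrightarrow> fst ((f ^^ k) (setv i 0 s)) v = fst s v)" if "k \<le> N" for k
    using that
  proof (induction k)
    case 0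
    then show ?case using init by simp
  next
    case (Suc k)
    let ?s = "(f ^^ k) (setv i 0 s)"
    have "fst (sem w c ?s) i = k"
      using Suc assms(1) by (simp add: sem_frame)
    then have *: "(f ^^ Suc k) (setv i 0 s) = setv i (Suc k) (sem w c ?s)"
      by (simp add: f_def Let_def)
    show ?case
      unfolding * using Suc step[of k ?s] by (auto simp: sem_frame)
  qed
  then show ?thesis using N by (simp add: f_def)
qed

section \<open>Compilation with a register stack\<close>

fun aexp_vars :: "aexp \<Rightarrow> nat set" where
  "aexp_vars (Num k) = {}"
| "aexp_vars (Var v) = {v}"
| "aexp_vars (Plus a b) = aexp_vars a \<union> aexp_vars b"
| "aexp_vars (Minus a b) = aexp_vars a \<union> aexp_vars b"
| "aexp_vars (Mem a) = aexp_vars a"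
| "aexp_vars (Inp a) = aexp_vars a"

text \<open>Bounds the stack registers used above the target: a right operand is evaluated one
  register higher, and a memory access needs one more for the offset \<open>K\<close>.\<close>

fun depth :: "aexp \<Rightarrow> nat" where
  "depth (Num k) = 0"
| "depth (Var v) = 0"
| "depth (Plus a b) = max (depth a) (Suc (depth b))"
| "depth (Minus a b) = max (depth a) (Suc (depth b))"
| "depth (Mem a) = max (depth a) 1"
| "depth (Inp a) = depth a"

text \<open>
  Register layout of compiled code: variables are kept below \<open>D\<close>, the registers from \<open>D\<close> to
  \<open>K - 1\<close> form an evaluation stack, and cell \<open>x\<close> of the memory is register \<open>K + x\<close>.
\<close>

fun compa :: "nat \<Rightarrow> nat \<Rightarrow> aexp \<Rightarrow> instr list" where
  "compa K d (Num k) = [LoadConst d k]"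
| "compa K d (Var v) = [LoadConst d 0, Add d d v]"
| "compa K d (Plus a b) = compa K d a @ compa K (Suc d) b @ [Add d d (Suc d)]"
| "compa K d (Minus a b) = compa K d a @ compa K (Suc d) b @ [Sub d d (Suc d)]"
| "compa K d (Mem a) = compa K d a @ [LoadConst (Suc d) K, Add d d (Suc d), Load d d]"
| "compa K d (Inp a) = compa K d a @ [ReadInput d d]"

text \<open>Jumps are absolute, hence the parameter \<open>l\<close>, the address of the first
  instruction. A loop has its test at \<open>l + 1\<close> and its body at \<open>l + 3\<close>.
  Adding 0 replaces a move instruction.\<close>

fun compc :: "nat \<Rightarrow> nat \<Rightarrow> nat \<Rightarrow> com \<Rightarrow> instr list" where
  "compc D K l (Assign v a) = compa K D a @ [LoadConst (Suc D) 0, Add v D (Suc D)]"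
| "compc D K l (Put a b) = compa K D a @ compa K (Suc D) b @
     [LoadConst (D + 2) K, Add D D (D + 2), Store D (Suc D)]"
| "compc D K l (c ;; d) =
     (let p = compc D K l c in p @ compc D K (l + length p) d)"
| "compc D K l (For i m c) =
     (let p = compc D K (l + 3) c in
       [LoadConst i 0, Sub D m i, JumpZero D (l + 6 + length p)] @ p @
       [LoadConst D 1, Add i i D, Jump (Suc l)])"

fun well_formed :: "nat \<Rightarrow> nat \<Rightarrow> com \<Rightarrow> bool" where
  "well_formed D K (Assign v a) \<longleftrightarrow>
     v < D \<and> (\<forall>v\<in>aexp_vars a. v < D) \<and> D + depth a < K \<and> Suc D < K"
| "well_formed D K (Put a b) \<longleftrightarrow>
     (\<forall>v\<in>aexp_vars a \<union> aexp_vars b. v < D) \<and> D + depth a < K \<and> Suc D + depth b < K \<and> D + 2 < K"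
| "well_formed D K (c ;; d) \<longleftrightarrow> well_formed D K c \<and> well_formed D K d"
| "well_formed D K (For i m c) \<longleftrightarrow>
     i < D \<and> m < D \<and> D < K \<and> i \<notin> assigned c \<and> well_formed D K c"

text \<open>The argument of the polynomial is a common upper bound on all loop bounds. A round costs
  5 steps beside the body: 2 for the test, 3 for the increment and the jump back. Initialization and
  the last test cost 3.\<close>

fun time :: "nat \<Rightarrow> com \<Rightarrow> nat poly" where
  "time K (Assign v a) = [:length (compa K 0 a) + 2:]"
| "time K (Put a b) = [:length (compa K 0 a) + length (compa K 0 b) + 3:]"
| "time K (c ;; d) = time K c + time K d"
| "time K (For i m c) = [:3:] + [:0, 1:] * (time K c + [:5:])"

lemma length_compa: "length (compa K d a) = length (compa K 0 a)"
proof (induction a arbitrary: d)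
  case (Plus a b)
  show ?case using Plus(1)[of d] Plus(2)[of "Suc d"] Plus(2)[of "Suc 0"] by simp
next
  case (Minus a b)
  show ?case using Minus(1)[of d] Minus(2)[of "Suc d"] Minus(2)[of "Suc 0"] by simp
next
  case (Mem a)
  show ?case using Mem[of d] by simp
next
  case (Inp a)
  show ?case using Inp[of d] by simp
qed auto

section \<open>Execution of compiled code\<close>

definition code_at :: "instr list \<Rightarrow> nat \<Rightarrow> instr list \<Rightarrow> bool" where
  "code_at M l p \<longleftrightarrow> (\<forall>k < length p. l + k < length M \<and> M ! (l + k) = p ! k)"

lemma code_at_Nil [simp]: "code_at M l []"
  by (simp add: code_at_def)

lemma code_at_Cons [simp]:
  "code_at M l (x # p) \<longleftrightarrow> l < length M \<and> M ! l = x \<and> code_at M (Suc l) p"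
  unfolding code_at_def
  by (auto simp: less_Suc_eq_0_disj nth_Cons split: nat.splits)

lemma code_at_append [simp]:
  "code_at M l (p @ q) \<longleftrightarrow> code_at M l p \<and> code_at M (l + length p) q"
  by (induction p arbitrary: l) auto

definition runs_to :: "instr list \<Rightarrow> bool list \<Rightarrow> ram_config \<Rightarrow> nat \<Rightarrow> ram_config \<Rightarrow> bool" where
  "runs_to M w c t c' \<longleftrightarrow> (ram_step M w ^^ t) c = c'"

lemma runs_to_0 [simp]: "runs_to M w c 0 c' \<longleftrightarrow> c = c'"
  by (simp add: runs_to_def)

lemma runs_to_trans:
  "runs_to M w c t c' \<Longrightarrow> runs_to M w c' t' c'' \<Longrightarrow> runs_to M w c (t + t') c''"
  unfolding runs_to_def by (subst add.commute) (simp add: funpow_add)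

lemma runs_to_Suc [simp]:
  "l < length M \<Longrightarrow>
    runs_to M w (l, R) (Suc t) c \<longleftrightarrow> runs_to M w (exec_instr w (M ! l) (l, R)) t c"
  by (simp add: runs_to_def ram_step_def ram_halted_def funpow_swap1)

definition represents :: "nat \<Rightarrow> nat \<Rightarrow> store \<Rightarrow> (nat \<Rightarrow> nat) \<Rightarrow> bool" where
  "represents D K s R \<longleftrightarrow> (\<forall>v < D. R v = fst s v) \<and> (\<forall>x. R (K + x) = snd s x)"

lemma represents_cong:
  assumes "represents D K s R" "\<And>r. r < D \<or> K \<le> r \<Longrightarrow> R' r = R r"
  shows "represents D K s R'"
  using assms by (simp add: represents_def)

text \<open>Evaluation at \<open>d\<close> leaves the registers below \<open>d\<close> alone, so a
  left operand survives while the right one is computed one register higher. The code has no jumps,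
  so its length is its running time.\<close>

lemma compa_correct:
  assumes "represents D K s R" "\<forall>v\<in>aexp_vars a. v < D" "D \<le> d" "d + depth a < K"
    "code_at M l (compa K d a)"
  shows "\<exists>R'. runs_to M w (l, R) (length (compa K d a)) (l + length (compa K d a), R') \<and>
    R' d = aval w a s \<and> (\<forall>r. r < d \<or> K \<le> r \<longrightarrow> R' r = R r)"
  using assms
proof (induction a arbitrary: d l R)
  case (Num k)
  then show ?case
    by (intro exI[of _ "R(d := k)"]) (auto simp: fun_eq_iff)
next
  case (Var v)
  then show ?case
    by (intro exI[of _ "R(d := R v)"])
      (auto simp: represents_def fun_eq_iff)
next
  case (Plus a b)
  have depth: "d + depth a < K" "Suc d + depth b < K"
    using Plus.prems(4) by auto
  from Plus.prems depth Plus.IH(1)[of R d l] obtain R1 where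
    R1: "runs_to M w (l, R) (length (compa K d a)) (l + length (compa K d a), R1)"
      "R1 d = aval w a s" "\<forall>r. r < d \<or> K \<le> r \<longrightarrow> R1 r = R r" by auto
  have "represents D K s R1"
    by (rule represents_cong[OF Plus.prems(1)]) (use R1(3) Plus.prems(3) in auto)
  with Plus.prems depth Plus.IH(2)[of R1 "Suc d" "l + length (compa K d a)"] obtain R2 where
    R2: "runs_to M w (l + length (compa K d a), R1) (length (compa K (Suc d) b))
        (l + length (compa K d a) + length (compa K (Suc d) b), R2)"
      "R2 (Suc d) = aval w b s" "\<forall>r. r < Suc d \<or> K \<le> r \<longrightarrow> R2 r = R1 r" by auto
  have "runs_to M w (l + length (compa K d a) + length (compa K (Suc d) b), R2) (Suc 0)
      (l + length (compa K d (Plus a b)), R2(d := R2 d + R2 (Suc d)))"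
    using Plus.prems(5) by (auto simp: fun_eq_iff add_ac)
  from runs_to_trans[OF runs_to_trans[OF R1(1) R2(1)] this] show ?case
    using R1 R2 Plus.prems(4) by (intro exI[of _ "R2(d := R2 d + R2 (Suc d))"]) (auto simp: add_ac fun_upd_def)
next
  case (Minus a b)
  have depth: "d + depth a < K" "Suc d + depth b < K"
    using Minus.prems(4) by auto
  from Minus.prems depth Minus.IH(1)[of R d l] obtain R1 where
    R1: "runs_to M w (l, R) (length (compa K d a)) (l + length (compa K d a), R1)"
      "R1 d = aval w a s" "\<forall>r. r < d \<or> K \<le> r \<longrightarrow> R1 r = R r" by auto
  have "represents D K s R1"
    by (rule represents_cong[OF Minus.prems(1)]) (use R1(3) Minus.prems(3) in auto)
  with Minus.prems depth Minus.IH(2)[of R1 "Suc d" "l + length (compa K d a)"] obtain R2 where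
    R2: "runs_to M w (l + length (compa K d a), R1) (length (compa K (Suc d) b))
        (l + length (compa K d a) + length (compa K (Suc d) b), R2)"
      "R2 (Suc d) = aval w b s" "\<forall>r. r < Suc d \<or> K \<le> r \<longrightarrow> R2 r = R1 r" by auto
  have "runs_to M w (l + length (compa K d a) + length (compa K (Suc d) b), R2) (Suc 0)
      (l + length (compa K d (Minus a b)), R2(d := R2 d - R2 (Suc d)))"
    using Minus.prems(5) by (auto simp: fun_eq_iff add_ac)
  from runs_to_trans[OF runs_to_trans[OF R1(1) R2(1)] this] show ?case
    using R1 R2 Minus.prems(4) by (intro exI[of _ "R2(d := R2 d - R2 (Suc d))"]) (auto simp: add_ac fun_upd_def)
next
  case (Mem a)
  have depth: "d + depth a < K" "Suc d < K"
    using Mem.prems(4) by auto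
  from Mem.prems depth Mem.IH[of R d l] obtain R1 where
    R1: "runs_to M w (l, R) (length (compa K d a)) (l + length (compa K d a), R1)"
      "R1 d = aval w a s" "\<forall>r. r < d \<or> K \<le> r \<longrightarrow> R1 r = R r" by auto
  have mem: "represents D K s R1"
    by (rule represents_cong[OF Mem.prems(1)]) (use R1(3) Mem.prems(3) in auto)
  let ?R = "R1(Suc d := K, d := R1 (R1 d + K))"
  have "runs_to M w (l + length (compa K d a), R1) (Suc (Suc (Suc 0)))
      (l + length (compa K d (Mem a)), ?R)"
    using Mem.prems(4,5)
    by (auto simp: fun_eq_iff add_ac)
  from runs_to_trans[OF R1(1) this] show ?case
    using R1 Mem.prems(4) mem by (intro exI[of _ ?R]) (auto simp: represents_def add_ac fun_upd_def)
next
  case (Inp a)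
  from Inp.prems Inp.IH[of R d l] obtain R1 where
    R1: "runs_to M w (l, R) (length (compa K d a)) (l + length (compa K d a), R1)"
      "R1 d = aval w a s" "\<forall>r. r < d \<or> K \<le> r \<longrightarrow> R1 r = R r" by auto
  let ?R = "R1(d := if R1 d < length w \<and> w ! R1 d then 1 else 0)"
  have "runs_to M w (l + length (compa K d a), R1) (Suc 0) (l + length (compa K d (Inp a)), ?R)"
    using Inp.prems
    by (auto simp: fun_eq_iff)
  from runs_to_trans[OF R1(1) this] show ?case
    using R1 Inp.prems(4) by (intro exI[of _ ?R]) (auto simp: fun_upd_def)
qed

text \<open>Structural induction. Loop bounds are never assigned, so their estimate by
  \<open>B\<close> made at the start remains valid in every subprogram.\<close>

lemma compc_correct:
  assumes "well_formed D K c" "\<forall>v\<in>bounds c. v \<notin> assigned c \<and> fst s v \<le> B"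
    "represents D K s R" "code_at M l (compc D K l c)"
  shows "\<exists>t R'. t \<le> poly (time K c) B \<and>
    runs_to M w (l, R) t (l + length (compc D K l c), R') \<and> represents D K (sem w c s) R'"
  using assms
proof (induction c arbitrary: s l R)
  case (Assign v a)
  from Assign.prems compa_correct[of D K s R a D M l w] obtain R1 where
    R1: "runs_to M w (l, R) (length (compa K D a)) (l + length (compa K D a), R1)"
      "R1 D = aval w a s" "\<forall>r. r < D \<or> K \<le> r \<longrightarrow> R1 r = R r" by auto
  let ?R = "R1(Suc D := 0, v := R1 D)"
  have "runs_to M w (l + length (compa K D a), R1) (Suc (Suc 0))
      (l + length (compc D K l (Assign v a)), ?R)"
    using Assign.prems
    by (auto simp: fun_eq_iff)
  from runs_to_trans[OF R1(1) this]
  have "runs_to M w (l, R) (length (compa K D a) + 2) (l + length (compc D K l (Assign v a)), ?R)"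
    by simp
  moreover have "represents D K (sem w (Assign v a) s) ?R"
    using R1 Assign.prems by (auto simp: represents_def)
  ultimately show ?case by (auto simp: length_compa[of K D])
next
  case (Put a b)
  from Put.prems compa_correct[of D K s R a D M l w] obtain R1 where
    R1: "runs_to M w (l, R) (length (compa K D a)) (l + length (compa K D a), R1)"
      "R1 D = aval w a s" "\<forall>r. r < D \<or> K \<le> r \<longrightarrow> R1 r = R r" by auto
  have "represents D K s R1"
    by (rule represents_cong[OF Put.prems(3)]) (use R1(3) in auto)
  with Put.prems compa_correct[of D K s R1 b "Suc D" M "l + length (compa K D a)" w] obtain R2 where
    R2: "runs_to M w (l + length (compa K D a), R1) (length (compa K (Suc D) b))
        (l + length (compa K D a) + length (compa K (Suc D) b), R2)"
      "R2 (Suc D) = aval w b s" "\<forall>r. r < Suc D \<or> K \<le> r \<longrightarrow> R2 r = R1 r" by auto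
  let ?R = "R2(D + 2 := K, D := R2 D + K, R2 D + K := R2 (Suc D))"
  have "runs_to M w (l + length (compa K D a) + length (compa K (Suc D) b), R2) (Suc (Suc (Suc 0)))
      (l + length (compc D K l (Put a b)), ?R)"
    using Put.prems
    by (auto simp: fun_eq_iff add_ac)
  from runs_to_trans[OF runs_to_trans[OF R1(1) R2(1)] this]
  have "runs_to M w (l, R) (length (compa K D a) + length (compa K (Suc D) b) + 3)
      (l + length (compc D K l (Put a b)), ?R)"
    by (simp add: add_ac eval_nat_numeral)
  moreover have "represents D K (sem w (Put a b) s) ?R"
    using R1 R2 Put.prems by (auto simp: represents_def)
  ultimately show ?case
    by (auto simp: length_compa[of K D] length_compa[of K "Suc D"])
next
  case (Seq c d)
  let ?l = "l + length (compc D K l c)"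
  from Seq.prems Seq.IH(1)[of s R l] obtain t1 R1 where 1: "t1 \<le> poly (time K c) B"
    "runs_to M w (l, R) t1 (?l, R1)" "represents D K (sem w c s) R1"
    by (auto simp: Let_def)
  have "\<forall>v\<in>bounds d. v \<notin> assigned d \<and> fst (sem w c s) v \<le> B"
    using Seq.prems(2) by (auto simp: sem_frame)
  with Seq.prems Seq.IH(2)[of "sem w c s" R1 ?l] 1(3) obtain t2 R2 where
    2: "t2 \<le> poly (time K d) B" "runs_to M w (?l, R1) t2 (?l + length (compc D K ?l d), R2)"
      "represents D K (sem w d (sem w c s)) R2"
    by (auto simp: Let_def)
  show ?case
    using 1(1) 2(1,3) runs_to_trans[OF 1(2) 2(2)]
    by (intro exI[of _ "t1 + t2"] exI[of _ R2]) (auto simp: Let_def add_ac)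
next
  case (For i m c)
  define p where "p = compc D K (l + 3) c"
  define f where "f = (\<lambda>s. let s' = sem w c s in setv i (Suc (fst s' i)) s')"
  define N where "N = fst s m"
  have code: "code_at M l ([LoadConst i 0, Sub D m i, JumpZero D (l + 6 + length p)] @ p @
       [LoadConst D 1, Add i i D, Jump (Suc l)])"
    using For.prems(4) by (simp add: Let_def p_def)
  have im: "i \<noteq> m" "i < D" "m < D" "D < K" and nb: "\<forall>v\<in>insert m (bounds c). v \<notin> insert i (assigned c)"
    and B: "N \<le> B" and wf: "well_formed D K c" "i \<notin> assigned c"
    using For.prems by (auto simp: N_def)
  \<comment> \<open>Here \<open>k\<close> is the number of rounds still to come; the additional 2
    steps are the test that leaves the loop.\<close>
  have "\<exists>t R'. t \<le> k * (poly (time K c) B + 5) + 2 \<and>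
      runs_to M w (Suc l, R1) t (l + 6 + length p, R') \<and> represents D K ((f ^^ k) s1) R'"
    if "represents D K s1 R1" "fst s1 i = N - k" "k \<le> N"
      "\<forall>v\<in>insert m (bounds c). fst s1 v = fst s v" for k s1 R1
    using that
  proof (induction k arbitrary: s1 R1)
    case 0
    let ?R = "R1(D := 0)"
    have "R1 m - R1 i = 0"
      using 0 im by (auto simp: represents_def N_def)
    then have "runs_to M w (Suc l, R1) (Suc (Suc 0)) (l + 6 + length p, ?R)"
      using code
    by (auto simp: fun_eq_iff)
    moreover have "represents D K s1 ?R"
      by (rule represents_cong[OF 0(1)]) (use im in auto)
    ultimately show ?case by (intro exI[of _ 2]) (auto simp: numeral_2_eq_2)
  next
    case (Suc k)
    let ?R = "R1(D := R1 m - R1 i)"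
    have "R1 m - R1 i \<noteq> 0"
      using Suc.prems im by (auto simp: represents_def N_def)
    then have s1: "runs_to M w (Suc l, R1) (Suc (Suc 0)) (l + 3, ?R)"
      using code
    by (auto simp: fun_eq_iff)
    have "represents D K s1 ?R"
      by (rule represents_cong[OF Suc.prems(1)]) (use im in auto)
    moreover have "\<forall>v\<in>bounds c. v \<notin> assigned c \<and> fst s1 v \<le> B"
      using For.prems(2) Suc.prems(4) nb by auto
    moreover have "code_at M (l + 3) (compc D K (l + 3) c)"
      using code by (simp add: p_def eval_nat_numeral)
    ultimately obtain t R2 where t: "t \<le> poly (time K c) B"
      "runs_to M w (l + 3, ?R) t (l + 3 + length p, R2)" "represents D K (sem w c s1) R2"
      using For.IH[OF wf(1), of s1 ?R "l + 3"] by (auto simp: p_def fun_upd_def)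
    let ?R3 = "R2(D := 1, i := R2 i + 1)"
    have "runs_to M w (l + 3 + length p, R2) (Suc (Suc (Suc 0))) (Suc l, ?R3)"
      using code im
    by (auto simp: fun_eq_iff eval_nat_numeral)
    note r = runs_to_trans[OF runs_to_trans[OF s1 t(2)] this]
    have "represents D K (f s1) ?R3"
      using t(3) im by (auto simp: represents_def f_def Let_def)
    moreover have "fst (f s1) i = N - k"
      using Suc.prems wf(2) by (simp add: f_def Let_def sem_frame)
    moreover have "\<forall>v\<in>insert m (bounds c). fst (f s1) v = fst s v"
      using Suc.prems(4) nb by (auto simp: f_def Let_def sem_frame)
    ultimately obtain t' R' where t': "t' \<le> k * (poly (time K c) B + 5) + 2"
      "runs_to M w (Suc l, ?R3) t' (l + 6 + length p, R')" "represents D K ((f ^^ k) (f s1)) R'"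
      using Suc.IH[of "f s1" ?R3] Suc.prems(3) by (auto simp: fun_upd_def)
    show ?case
      using runs_to_trans[OF r t'(2)] t(1) t'(1,3)
      by (intro exI[of _ "Suc (Suc 0) + t + Suc (Suc (Suc 0)) + t'"] exI[of _ R'])
        (auto simp: funpow_swap1)
  qed
  note loop = this
  have "represents D K (setv i 0 s) (R(i := 0))"
    using For.prems(3) im by (auto simp: represents_def)
  from loop[OF this, of N] im nb obtain t R' where t: "t \<le> N * (poly (time K c) B + 5) + 2"
    "runs_to M w (Suc l, R(i := 0)) t (l + 6 + length p, R')"
    "represents D K ((f ^^ N) (setv i 0 s)) R'"
    by auto
  have "runs_to M w (l, R) (Suc 0) (Suc l, R(i := 0))"
    using code
    by (auto simp: fun_eq_iff)
  note r = runs_to_trans[OF this t(2)]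
  have "Suc 0 + t \<le> 3 + B * (poly (time K c) B + 5)"
    using t(1) mult_le_mono1[OF B, of "poly (time K c) B + 5"] by linarith
  moreover have "l + length (compc D K l (For i m c)) = l + 6 + length p"
    by (simp add: p_def Let_def)
  moreover have "sem w (For i m c) s = (f ^^ N) (setv i 0 s)"
    by (simp add: f_def N_def)
  ultimately show ?case
    using r t(3) by (intro exI[of _ "Suc 0 + t"] exI[of _ R']) (simp add: add.assoc del: sem.simps compc.simps)
qed

section \<open>From loop programs to polynomial-time decidability\<close>

definition initial_store :: "bool list \<Rightarrow> store" where
  "initial_store w = ((\<lambda>_. 0)(0 := length w), \<lambda>_. 0)"

text \<open>
  Two consecutive programs are considered because a variable computed by the first one may be a
  loop bound of the second one.
\<close>

lemma poly_time_decidableI: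
  assumes wf: "well_formed D K c" "well_formed D K d" "0 < D" "D \<le> K"
    and bc: "\<And>x w v. x \<in> A \<Longrightarrow> enc x w \<Longrightarrow> v \<in> bounds c \<Longrightarrow>
      v \<notin> assigned c \<and> fst (initial_store w) v \<le> length w"
    and bd: "\<And>x w v. x \<in> A \<Longrightarrow> enc x w \<Longrightarrow> v \<in> bounds d \<Longrightarrow>
      v \<notin> assigned d \<and> fst (sem w c (initial_store w)) v \<le> length w"
    and answer: "\<And>x w. x \<in> A \<Longrightarrow> enc x w \<Longrightarrow>
      fst (sem w d (sem w c (initial_store w))) 0 = (if P x then 1 else 0)"
  shows "poly_time_decidable enc A P"
proof -
  define l where "l = length (compc D K 0 c)"
  define M where "M = compc D K 0 c @ compc D K l d"
  have at: "code_at M 0 (compc D K 0 c)" "code_at M l (compc D K l d)"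
    by (auto simp: code_at_def M_def l_def nth_append)
  have "ram_answers_within M w (poly (time K c + time K d) (length w)) (P x)"
    if x: "x \<in> A" "enc x w" for x w
  proof -
    let ?R = "(\<lambda>_. 0)(0 := length w)" and ?s = "initial_store w"
    have "represents D K ?s ?R"
      using wf(3,4) by (auto simp: represents_def initial_store_def)
    from compc_correct[OF wf(1) _ this at(1), of "length w" w] bc[OF x] obtain t1 R1 where
      1: "t1 \<le> poly (time K c) (length w)" "runs_to M w (0, ?R) t1 (l, R1)"
        "represents D K (sem w c ?s) R1"
      by (auto simp: l_def)
    from compc_correct[OF wf(2) _ 1(3) at(2), of "length w" w] bd[OF x] obtain t2 R2 where
      2: "t2 \<le> poly (time K d) (length w)" "runs_to M w (l, R1) t2 (length M, R2)"
        "represents D K (sem w d (sem w c ?s)) R2"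
      by (auto simp: M_def l_def)
    \<comment> \<open>A halted configuration is a fixed point, so the machine may be observed at the
      full time bound instead of the exact number of steps.\<close>
    have halt: "(ram_step M w ^^ k) (length M, R2) = (length M, R2)" for k
      by (induction k) (auto simp: ram_step_def ram_halted_def)
    define t where "t = poly (time K c + time K d) (length w)"
    have "t = (t - (t1 + t2)) + (t1 + t2)"
      using 1(1) 2(1) by (simp add: t_def)
    moreover have "(ram_step M w ^^ (t1 + t2)) (0, ?R) = (length M, R2)"
      using runs_to_trans[OF 1(2) 2(2)] by (simp add: runs_to_def)
    ultimately have "ram_run M w t = (length M, R2)"
      unfolding ram_run_def ram_init_def by (metis comp_apply funpow_add halt)
    moreover have "R2 0 = (if P x then 1 else 0)"
      using 2(3) answer[OF x] wf(3) by (simp add: represents_def)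
    ultimately show ?thesis
      by (simp add: ram_answers_within_def ram_halted_def t_def)
  qed
  then show ?thesis unfolding poly_time_decidable_def by blast
qed

section \<open>Arc consistency\<close>

definition adj :: "bool list \<Rightarrow> nat \<Rightarrow> nat \<Rightarrow> nat \<Rightarrow> bool" where
  "adj w n i j \<longleftrightarrow> i * n + j < length w \<and> w ! (i * n + j)"

definition supported :: "(nat \<Rightarrow> nat \<Rightarrow> bool) \<Rightarrow> nat \<Rightarrow> (nat \<times> nat) set \<Rightarrow> nat \<Rightarrow> nat \<Rightarrow> nat \<Rightarrow> bool" where
  "supported E n S x y b \<longleftrightarrow>
     (\<exists>c<n. (y, c) \<in> S \<and> (E x y \<longrightarrow> E b c) \<and> (E y x \<longrightarrow> E c b))"

text \<open>
  \<open>S\<close> encodes lists of candidate images: \<open>(x, b) \<in> S\<close> says that \<open>b\<close> is in the list of \<open>x\<close>.  As \<open>y\<close>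
  need not be a neighbour of \<open>x\<close>, either all lists are empty or none is.
\<close>

definition arc_consistent :: "(nat \<Rightarrow> nat \<Rightarrow> bool) \<Rightarrow> nat \<Rightarrow> (nat \<times> nat) set \<Rightarrow> bool" where
  "arc_consistent E n S \<longleftrightarrow> (\<forall>(x, b) \<in> S. \<forall>y<n. supported E n S x y b)"

definition identifying :: "nat \<Rightarrow> nat \<Rightarrow> nat \<Rightarrow> nat \<Rightarrow> (nat \<times> nat) set" where
  "identifying n u v a = {(x, b). x < n \<and> b < n \<and> (x = u \<or> x = v \<longrightarrow> b = a)}"

text \<open>Independent of the algorithm: some arc consistent \<open>C\<close> within the initial
  lists contains \<open>(u, a)\<close> iff the largest one does. One entry suffices, because
  \<open>a\<close> is the only candidate for \<open>u\<close> and no list is empty unless all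
  are.\<close>

definition foldable :: "(nat \<Rightarrow> nat \<Rightarrow> bool) \<Rightarrow> nat \<Rightarrow> nat \<Rightarrow> nat \<Rightarrow> nat \<Rightarrow> bool" where
  "foldable E n u v a \<longleftrightarrow>
     u \<noteq> v \<and> (\<exists>C. arc_consistent E n C \<and> C \<subseteq> identifying n u v a \<and> (u, a) \<in> C)"

lemma supported_mono: "supported E n S x y b \<Longrightarrow> S \<subseteq> T \<Longrightarrow> supported E n T x y b"
  unfolding supported_def by blast

text \<open>
  The invariant of a sweep over all triples \<open>(x, y, b)\<close> that starts with the lists \<open>S\<^sub>0\<close> and updates
  them in place.  \<open>Q\<close> is the set of triples treated so far; the last conjunct makes a sweep
  without effect a proof of arc consistency.
\<close>

definition sweep_inv where
  "sweep_inv E n S\<^sub>0 Q S \<longleftrightarrow> S \<subseteq> S\<^sub>0 \<and>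
     (\<forall>C. arc_consistent E n C \<longrightarrow> C \<subseteq> S\<^sub>0 \<longrightarrow> C \<subseteq> S) \<and>
     (S = S\<^sub>0 \<longrightarrow> (\<forall>(x, y, b) \<in> Q. (x, b) \<in> S\<^sub>0 \<longrightarrow> supported E n S\<^sub>0 x y b))"

text \<open>An arc consistent \<open>C\<close> within \<open>S\<close> cannot contain an unsupported
  pair, since support is monotone in the lists; so the deletion loses no solution. If the lists
  still equal \<open>S\<^sub>0\<close> afterwards, then \<open>(x, b)\<close> was not in them and
  the new triple is harmless.\<close>

lemma sweep_inv_step:
  assumes "sweep_inv E n S\<^sub>0 Q S" "y < n"
  shows "sweep_inv E n S\<^sub>0 (insert (x, y, b) Q) (if supported E n S x y b then S else S - {(x, b)})"
proof (cases "supported E n S x y b")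
  case True
  then show ?thesis using assms(1) unfolding sweep_inv_def by auto
next
  case False
  have "C \<subseteq> S - {(x, b)}" if C: "arc_consistent E n C" "C \<subseteq> S\<^sub>0" for C
  proof -
    have "C \<subseteq> S" using C assms(1) by (simp add: sweep_inv_def)
    moreover have "(x, b) \<notin> C"
      using C(1) assms(2) supported_mono[OF _ \<open>C \<subseteq> S\<close>] False unfolding arc_consistent_def by blast
    ultimately show ?thesis by blast
  qed
  moreover have "S - {(x, b)} = S\<^sub>0 \<Longrightarrow> S = S\<^sub>0 \<and> (x, b) \<notin> S\<^sub>0"
    using assms(1) unfolding sweep_inv_def by blast
  ultimately show ?thesis
    using False assms(1) unfolding sweep_inv_def by auto
qed

lemma sweep_inv_done:
  assumes "sweep_inv E n S {(x, y, b) |x y b. x < n \<and> y < n \<and> b < n} S" "S \<subseteq> {..<n} \<times> {..<n}"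
  shows "arc_consistent E n S"
  using assms unfolding sweep_inv_def arc_consistent_def by fastforce

text \<open>
  Each sweep either finds the lists arc consistent or deletes an entry, so \<open>n\<^sup>2\<close> sweeps suffice.
\<close>

definition sweeps_inv where
  "sweeps_inv E n S\<^sub>0 k S \<longleftrightarrow> S \<subseteq> S\<^sub>0 \<and> (\<forall>C. arc_consistent E n C \<longrightarrow> C \<subseteq> S\<^sub>0 \<longrightarrow> C \<subseteq> S) \<and>
     (arc_consistent E n S \<or> card S + k \<le> n * n)"

lemma sweeps_inv_0:
  assumes "S \<subseteq> {..<n} \<times> {..<n}"
  shows "sweeps_inv E n S 0 S"
  using card_mono[OF _ assms] by (simp add: sweeps_inv_def)

text \<open>A sweep without effect proves arc consistency. Otherwise \<open>S\<close> was not arc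
  consistent, as the sweep would have preserved it, and the lost entry makes up for the increase of
  \<open>k\<close>.\<close>

lemma sweeps_inv_Suc:
  assumes inv: "sweeps_inv E n S\<^sub>0 k S" and box: "S \<subseteq> {..<n} \<times> {..<n}"
    and sweep: "sweep_inv E n S {(x, y, b) |x y b. x < n \<and> y < n \<and> b < n} S'"
  shows "sweeps_inv E n S\<^sub>0 (Suc k) S'"
proof -
  have sub: "S' \<subseteq> S" and keep: "\<forall>C. arc_consistent E n C \<longrightarrow> C \<subseteq> S \<longrightarrow> C \<subseteq> S'"
    using sweep unfolding sweep_inv_def by simp_all
  have sub\<^sub>0: "S \<subseteq> S\<^sub>0" and keep\<^sub>0: "\<forall>C. arc_consistent E n C \<longrightarrow> C \<subseteq> S\<^sub>0 \<longrightarrow> C \<subseteq> S"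
    and ac: "arc_consistent E n S \<or> card S + k \<le> n * n"
    using inv unfolding sweeps_inv_def by simp_all
  have "arc_consistent E n S' \<or> card S' + Suc k \<le> n * n"
  proof (cases "S' = S")
    case True
    with sweep have "sweep_inv E n S {(x, y, b) |x y b. x < n \<and> y < n \<and> b < n} S"
      by (simp only:)
    from sweep_inv_done[OF this box] show ?thesis using True by (simp only: simp_thms)
  next
    case False
    have "\<not> arc_consistent E n S"
      using keep sub False by (metis subset_antisym subset_refl)
    moreover have "card S' < card S"
    proof (rule psubset_card_mono)
      show "finite S" using box by (rule finite_subset) simp
      show "S' \<subset> S" using sub False by (rule psubsetI)
    qed
    ultimately show ?thesis using ac by linarith
  qed
  moreover have "S' \<subseteq> S\<^sub>0" using sub sub\<^sub>0 by (rule subset_trans)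
  moreover have "\<forall>C. arc_consistent E n C \<longrightarrow> C \<subseteq> S\<^sub>0 \<longrightarrow> C \<subseteq> S'"
    using keep keep\<^sub>0 by metis
  ultimately show ?thesis unfolding sweeps_inv_def by (intro conjI)
qed

text \<open>For \<open>k = n * n\<close> the alternative to arc consistency leaves \<open>S\<close>
  empty, hence trivially arc consistent. So \<open>S\<close> is the largest arc consistent subset of
  \<open>S\<^sub>0\<close>.\<close>

lemma sweeps_inv_done:
  assumes inv: "sweeps_inv E n S\<^sub>0 (n * n) S" and box: "S \<subseteq> {..<n} \<times> {..<n}"
  shows "p \<in> S \<longleftrightarrow> (\<exists>C. arc_consistent E n C \<and> C \<subseteq> S\<^sub>0 \<and> p \<in> C)"
proof -
  have "finite S" using box by (rule finite_subset) simp
  then have "arc_consistent E n S"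
    using inv by (auto simp: sweeps_inv_def arc_consistent_def)
  moreover have "S \<subseteq> S\<^sub>0" "\<And>C. arc_consistent E n C \<Longrightarrow> C \<subseteq> S\<^sub>0 \<Longrightarrow> C \<subseteq> S"
    using inv by (auto simp: sweeps_inv_def)
  ultimately show ?thesis by blast
qed


section \<open>The program\<close>

text \<open>In place of multiplication, repeated addition keeps \<open>j\<close> equal to
  \<open>i\<close> times the value of \<open>m\<close>; this yields row offsets of a matrix.\<close>

definition stride :: "nat \<Rightarrow> nat \<Rightarrow> nat \<Rightarrow> com \<Rightarrow> com" where
  "stride i j m c = Assign j (Num 0) ;; For i m (c ;; Assign j (Plus (Var j) (Var m)))"

lemma assigned_stride [simp]: "assigned (stride i j m c) = {i, j} \<union> assigned c"
  and bounds_stride [simp]: "bounds (stride i j m c) = insert m (bounds c)"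
  by (auto simp: stride_def)

text \<open>The invariant has to ignore \<open>i\<close> and \<open>j\<close>, as both change
  outside the body \<open>c\<close>; their values are passed to the step instead.\<close>

lemma stride_rule:
  assumes c: "i \<notin> assigned c" "j \<notin> assigned c" "m \<notin> assigned c" "distinct [i, j, m]"
    and N: "fst s m = N"
    and indep: "\<And>k s x. P k (setv i x s) = P k s" "\<And>k s x. P k (setv j x s) = P k s"
    and init: "P 0 s"
    and step: "\<And>k s'. k < N \<Longrightarrow> fst s' i = k \<Longrightarrow> fst s' j = k * N \<Longrightarrow>
      (\<And>v. v \<notin> assigned c \<Longrightarrow> v \<noteq> i \<Longrightarrow> v \<noteq> j \<Longrightarrow> fst s' v = fst s v) \<Longrightarrow> P k s' \<Longrightarrow>
      P (Suc k) (sem w c s')"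
  shows "P N (sem w (stride i j m c) s)"
proof -
  let ?c = "c ;; Assign j (Plus (Var j) (Var m))"
  let ?s = "setv j 0 s"
  have "P N (sem w (For i m ?c) ?s) \<and> fst (sem w (For i m ?c) ?s) j = N * N"
  proof (rule For_rule[where P = "\<lambda>k s. P k s \<and> fst s j = k * N"])
    fix k and s' :: store
    assume k: "k < N" "fst s' i = k"
      and frame: "\<And>v. v \<notin> assigned ?c \<Longrightarrow> v \<noteq> i \<Longrightarrow> fst s' v = fst ?s v"
      and P: "P k s' \<and> fst s' j = k * N"
    have "P (Suc k) (sem w c s')"
      using k P frame by (intro step) auto
    moreover have "fst s' m = N"
      using frame[of m] c N by simp
    ultimately show "P (Suc k) (setv i (Suc k) (sem w ?c s')) \<and>
        fst (setv i (Suc k) (sem w ?c s')) j = Suc k * N"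
      using c P by (simp add: indep sem_frame)
  qed (use c N init indep in auto)
  then show ?thesis by (simp add: stride_def)
qed

text \<open>
  Variables: 0 length of the input and answer, 1 number \<open>n\<close> of vertices, 2 length of the input,
  3, 5, 6 the current \<open>u, v, a\<close> of \<^const>\<open>foldable\<close>, 7, 9, 11, 13 the vertices \<open>x, y, b, c\<close> of
  \<^const>\<open>supported\<close>, and 4, 8, 10, 12, 14 the values of 3, 7, 9, 11, 13 multiplied by \<open>n\<close>;
  15 nonzero if support was found, 16 nonzero if a fold was found, 17 number of sweeps,
  18, 19 auxiliary variables for the square root.
  The memory cell \<open>x * n + b\<close> is nonzero if \<open>b\<close> is in the list of \<open>x\<close>.  There is no conditional:
  nonzero numbers stand for truth, and \<open>1 - t\<close> for the negation of \<open>t\<close>.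
\<close>

definition search :: com where
  "search = Assign 15 (Num 0) ;; stride 13 14 1
     (Assign 15 (Plus (Var 15) (Minus (Num 1) (Plus (Minus (Num 1) (Mem (Plus (Var 10) (Var 13))))
       (Plus (Minus (Inp (Plus (Var 8) (Var 9))) (Inp (Plus (Var 12) (Var 13))))
         (Minus (Inp (Plus (Var 10) (Var 7))) (Inp (Plus (Var 14) (Var 11)))))))))"

text \<open>For truncated subtraction, \<open>1 - ((1 - s) + (1 - t))\<close> is the conjunction:
  the entry stays iff it was present and support was found.\<close>

definition revise :: com where
  "revise = search ;; Put (Plus (Var 8) (Var 11)) (Minus (Num 1)
     (Plus (Minus (Num 1) (Mem (Plus (Var 8) (Var 11)))) (Minus (Num 1) (Var 15))))"

definition sweep :: com where
  "sweep = stride 7 8 1 (stride 9 10 1 (stride 11 12 1 revise))"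

definition distance :: "nat \<Rightarrow> nat \<Rightarrow> aexp" where
  "distance i j = Plus (Minus (Var i) (Var j)) (Minus (Var j) (Var i))"

text \<open>The value written is nonzero iff \<open>x\<close> differs from both \<open>u\<close> and
  \<open>v\<close>, or \<open>b = a\<close>.\<close>

definition init_lists :: com where
  "init_lists = stride 7 8 1 (For 11 1 (Put (Plus (Var 8) (Var 11))
     (Plus (Minus (Num 1) (Plus (Minus (Num 1) (distance 7 3)) (Minus (Num 1) (distance 7 5))))
       (Minus (Num 1) (distance 11 6)))))"

text \<open>Variable 2 serves as the number of sweeps. Variable 16 never decreases, so it remembers
  folds found earlier.\<close>

definition attempt :: com where
  "attempt = init_lists ;; For 17 2 sweep ;;
     Assign 16 (Plus (Var 16) (Minus (Num 1)
       (Plus (Minus (Num 1) (Mem (Plus (Var 4) (Var 6)))) (Minus (Num 1) (distance 3 5)))))"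

definition find_fold :: com where
  "find_fold = Assign 16 (Num 0) ;; stride 3 4 1 (For 5 1 (For 6 1 attempt)) ;;
     Assign 0 (Minus (Num 1) (Var 16))"

text \<open>While variable 18 runs through \<open>k < n * n\<close>, variable 19 holds
  \<open>k * k\<close>, updated by \<open>2 * k + 1\<close>, and variable 1 counts the
  \<open>k\<close> whose square is below \<open>n * n\<close>.\<close>

definition square_root :: com where
  "square_root = Assign 2 (Var 0) ;; Assign 1 (Num 0) ;; Assign 19 (Num 0) ;;
     For 18 0 (Assign 1 (Plus (Var 1) (Minus (Num 1) (Minus (Num 1) (Minus (Var 0) (Var 19))))) ;;
       Assign 19 (Plus (Var 19) (Plus (Plus (Var 18) (Var 18)) (Num 1))))"

section \<open>Correctness of the program\<close>

lemma assigned_search [simp]: "assigned search = {13, 14, 15}"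
  by (auto simp: search_def)

lemma assigned_revise [simp]: "assigned revise = {13, 14, 15}"
  by (auto simp: revise_def)

lemma assigned_sweep [simp]: "assigned sweep = {7, 8, 9, 10, 11, 12, 13, 14, 15}"
  by (auto simp: sweep_def)

lemma assigned_init_lists [simp]: "assigned init_lists = {7, 8, 11}"
  by (auto simp: init_lists_def)

lemma assigned_attempt [simp]: "assigned attempt = {7, 8, 9, 10, 11, 12, 13, 14, 15, 16, 17}"
  by (auto simp: attempt_def)

lemma square_root_correct:
  assumes "fst s 0 = n * n"
  shows "fst (sem w square_root s) 1 = n" "fst (sem w square_root s) 2 = n * n"
proof -
  let ?c = "Assign 1 (Plus (Var 1) (Minus (Num 1) (Minus (Num 1) (Minus (Var 0) (Var 19))))) ;;
       Assign 19 (Plus (Var 19) (Plus (Plus (Var 18) (Var 18)) (Num 1)))"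
  let ?s = "setv 19 0 (setv 1 0 (setv 2 (fst s 0) s))"
  have "fst (sem w (For 18 0 ?c) ?s) 1 = min (n * n) n \<and> fst (sem w (For 18 0 ?c) ?s) 19 = (n * n) * (n * n)"
  proof (rule For_rule[where P = "\<lambda>k s. fst s 1 = min k n \<and> fst s 19 = k * k"])
    fix k and s' :: store
    assume k: "k < n * n" "fst s' 18 = k"
      and frame: "\<And>v. v \<notin> assigned ?c \<Longrightarrow> v \<noteq> 18 \<Longrightarrow> fst s' v = fst ?s v"
      and P: "fst s' 1 = min k n \<and> fst s' 19 = k * k"
    have "fst s' 0 = n * n" using frame[of 0] assms by simp
    moreover have "k * k < n * n \<longleftrightarrow> k < n"
      using mult_strict_mono[of k n k n] mult_le_mono[of n k n k] by (cases "k < n") auto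
    ultimately show "fst (setv 18 (Suc k) (sem w ?c s')) 1 = min (Suc k) n \<and>
        fst (setv 18 (Suc k) (sem w ?c s')) 19 = Suc k * Suc k"
      using k P by auto
  qed (use assms in auto)
  moreover have "min (n * n) n = n" by (cases n) auto
  ultimately show "fst (sem w square_root s) 1 = n" by (simp add: square_root_def)
  show "fst (sem w square_root s) 2 = n * n"
    using assms by (simp add: square_root_def sem_frame del: sem.simps(4))
qed

definition lists :: "nat \<Rightarrow> (nat \<Rightarrow> nat) \<Rightarrow> (nat \<times> nat) set" where
  "lists n f = {(x, b). x < n \<and> b < n \<and> f (x * n + b) \<noteq> 0}"

lemma lists_subset: "lists n f \<subseteq> {..<n} \<times> {..<n}"
  by (auto simp: lists_def)

text \<open>Uniqueness of quotient and remainder; distinct entries thus occupy distinct memory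
  cells.\<close>

lemma index_inj:
  fixes n :: nat
  assumes "b < n" "b' < n"
  shows "x * n + b = x' * n + b' \<longleftrightarrow> x = x' \<and> b = b'"
proof
  assume *: "x * n + b = x' * n + b'"
  have "x = (x * n + b) div n" "x' = (x' * n + b') div n" using assms by auto
  with * show "x = x' \<and> b = b'" by auto
qed auto

lemma lists_update:
  assumes "x < n" "b < n"
  shows "lists n (f(x * n + b := k)) =
    (if k = 0 then lists n f - {(x, b)} else insert (x, b) (lists n f))"
  using assms by (auto simp: lists_def index_inj)

context
  fixes w :: "bool list" and n :: nat
begin

lemma aval_adj:
  "fst s i = x * n \<Longrightarrow> fst s j = y \<Longrightarrow> aval w (Inp (Plus (Var i) (Var j))) s = of_bool (adj w n x y)"
  by (simp add: adj_def)

lemma search_correct: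
  assumes s: "fst s 1 = n" "fst s 7 = x" "fst s 8 = x * n" "fst s 9 = y" "fst s 10 = y * n"
    "fst s 11 = b" "fst s 12 = b * n" and y: "y < n"
  shows "fst (sem w search s) 15 \<noteq> 0 \<longleftrightarrow> supported (adj w n) n (lists n (snd s)) x y b"
    "snd (sem w search s) = snd s"
proof -
  let ?c = "Assign 15 (Plus (Var 15) (Minus (Num 1) (Plus (Minus (Num 1) (Mem (Plus (Var 10) (Var 13))))
       (Plus (Minus (Inp (Plus (Var 8) (Var 9))) (Inp (Plus (Var 12) (Var 13))))
         (Minus (Inp (Plus (Var 10) (Var 7))) (Inp (Plus (Var 14) (Var 11))))))))"
  let ?s = "setv 15 0 s"
  let ?G = "\<lambda>c. (y, c) \<in> lists n (snd s) \<and> (adj w n x y \<longrightarrow> adj w n b c) \<and> (adj w n y x \<longrightarrow> adj w n c b)"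
  have "(fst (sem w (stride 13 14 1 ?c) ?s) 15 \<noteq> 0 \<longleftrightarrow> (\<exists>c<n. ?G c)) \<and>
    snd (sem w (stride 13 14 1 ?c) ?s) = snd s"
  proof (rule stride_rule[where P = "\<lambda>k s'. (fst s' 15 \<noteq> 0 \<longleftrightarrow> (\<exists>c<k. ?G c)) \<and> snd s' = snd s"])
    fix k and s' :: store
    assume k: "k < n" "fst s' 13 = k" "fst s' 14 = k * n"
      and frame: "\<And>v. v \<notin> assigned ?c \<Longrightarrow> v \<noteq> 13 \<Longrightarrow> v \<noteq> 14 \<Longrightarrow> fst s' v = fst ?s v"
      and P: "(fst s' 15 \<noteq> 0 \<longleftrightarrow> (\<exists>c<k. ?G c)) \<and> snd s' = snd s"
    have eq: "fst s' 7 = x" "fst s' 8 = x * n" "fst s' 9 = y" "fst s' 10 = y * n"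
      "fst s' 11 = b" "fst s' 12 = b * n"
      using s by (simp_all add: frame)
    let ?m = "snd s (y * n + k)"
    have "fst (sem w ?c s') 15 = fst s' 15 + (1 - ((1 - ?m) +
        
          ((of_bool (adj w n x y) - of_bool (adj w n b k)) + (of_bool (adj w n y x) - of_bool (adj w n k b)))))"
      using P k(2,3) aval_adj[OF eq(2,3)] aval_adj[OF eq(4,1)] aval_adj[OF eq(6) k(2)] aval_adj[OF k(3) eq(5)]
      by (simp add: eq(4) del: aval.simps(6))
    \<comment> \<open>For bits, a truncated difference is 0 iff the first implies the second, and
      \<open>1\<close> minus a sum is nonzero iff all summands are 0.\<close>
    then have "fst (sem w ?c s') 15 \<noteq> 0 \<longleftrightarrow> fst s' 15 \<noteq> 0 \<or>
        ?m \<noteq> 0 \<and> (adj w n x y \<longrightarrow> adj w n b k) \<and> (adj w n y x \<longrightarrow> adj w n k b)"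
      by (cases ?m; cases "adj w n x y"; cases "adj w n b k"; cases "adj w n y x"; cases "adj w n k b")
        (simp_all del: sem.simps)
    then have "fst (sem w ?c s') 15 \<noteq> 0 \<longleftrightarrow> fst s' 15 \<noteq> 0 \<or> ?G k"
      using y k(1) by (simp add: lists_def del: sem.simps)
    moreover have "snd (sem w ?c s') = snd s"
      using P by simp
    ultimately show "(fst (sem w ?c s') 15 \<noteq> 0 \<longleftrightarrow> (\<exists>c<Suc k. ?G c)) \<and> snd (sem w ?c s') = snd s"
      using P unfolding Ex_less_Suc by blast
  qed (use s in auto)
  then show "fst (sem w search s) 15 \<noteq> 0 \<longleftrightarrow> supported (adj w n) n (lists n (snd s)) x y b"
    "snd (sem w search s) = snd s"
    by (simp_all add: search_def supported_def)
qed

lemma revise_correct: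
  assumes s: "fst s 1 = n" "fst s 7 = x" "fst s 8 = x * n" "fst s 9 = y" "fst s 10 = y * n"
    "fst s 11 = b" "fst s 12 = b * n" and xyb: "x < n" "y < n" "b < n"
    and S: "S = lists n (snd s)"
  shows "lists n (snd (sem w revise s)) =
    (if supported (adj w n) n S x y b then S else S - {(x, b)})"
proof -
  have "(x, b) \<in> S \<longleftrightarrow> snd s (x * n + b) \<noteq> 0"
    using xyb S by (simp add: lists_def)
  then show ?thesis
    using search_correct[OF s xyb(2)] s xyb S
    by (auto simp: revise_def sem_frame lists_update)
qed

lemma sweep_correct:
  assumes s: "fst s 1 = n"
  defines "S \<equiv> lists n (snd s)"
  shows "sweep_inv (adj w n) n S {(x, y, b) |x y b. x < n \<and> y < n \<and> b < n}
    (lists n (snd (sem w sweep s)))"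
proof -
  let ?I = "sweep_inv (adj w n) n S"
  \<comment> \<open>The loops are treated from the inside out; \<open>Q\<close> stands for the
    triples handled before the loop is entered.\<close>
  have 3: "?I (Q \<union> {(x, y, b) |b. b < n}) (lists n (snd (sem w (stride 11 12 1 revise) s')))"
    if s': "fst s' 1 = n" "fst s' 7 = x" "fst s' 8 = x * n" "fst s' 9 = y" "fst s' 10 = y * n"
      "x < n" "y < n" "?I Q (lists n (snd s'))" for Q x y s'
  proof (rule stride_rule[where P = "\<lambda>k t. ?I (Q \<union> {(x, y, b) |b. b < k}) (lists n (snd t))"])
    fix k and t :: store
    assume k: "k < n" "fst t 11 = k" "fst t 12 = k * n"
      and frame: "\<And>v. v \<notin> assigned revise \<Longrightarrow> v \<noteq> 11 \<Longrightarrow> v \<noteq> 12 \<Longrightarrow> fst t v = fst s' v"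
      and P: "?I (Q \<union> {(x, y, b) |b. b < k}) (lists n (snd t))"
    have "lists n (snd (sem w revise t)) = (if supported (adj w n) n (lists n (snd t)) x y k
        then lists n (snd t) else lists n (snd t) - {(x, k)})"
      by (rule revise_correct) (use s' k frame in auto)
    moreover have "Q \<union> {(x, y, b) |b. b < Suc k} = insert (x, y, k) (Q \<union> {(x, y, b) |b. b < k})"
      by (auto simp: less_Suc_eq)
    ultimately show "?I (Q \<union> {(x, y, b) |b. b < Suc k}) (lists n (snd (sem w revise t)))"
      using sweep_inv_step[OF P \<open>y < n\<close>] by simp
  qed (use s' in auto)
  let ?c3 = "stride 11 12 1 revise"
  have 2: "?I (Q \<union> {(x, y, b) |y b. y < n \<and> b < n}) (lists n (snd (sem w (stride 9 10 1 ?c3) s')))"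
    if s': "fst s' 1 = n" "fst s' 7 = x" "fst s' 8 = x * n" "x < n" "?I Q (lists n (snd s'))" for Q x s'
  proof (rule stride_rule[where P = "\<lambda>k t. ?I (Q \<union> {(x, y, b) |y b. y < k \<and> b < n}) (lists n (snd t))"])
    fix k and t :: store
    assume k: "k < n" "fst t 9 = k" "fst t 10 = k * n"
      and frame: "\<And>v. v \<notin> assigned ?c3 \<Longrightarrow> v \<noteq> 9 \<Longrightarrow> v \<noteq> 10 \<Longrightarrow> fst t v = fst s' v"
      and P: "?I (Q \<union> {(x, y, b) |y b. y < k \<and> b < n}) (lists n (snd t))"
    have "?I (Q \<union> {(x, y, b) |y b. y < k \<and> b < n} \<union> {(x, k, b) |b. b < n})
        (lists n (snd (sem w ?c3 t)))"
      by (rule 3) (use s' k frame P in auto)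
    moreover have "Q \<union> {(x, y, b) |y b. y < Suc k \<and> b < n} =
        Q \<union> {(x, y, b) |y b. y < k \<and> b < n} \<union> {(x, k, b) |b. b < n}"
      by (auto simp: less_Suc_eq)
    ultimately show "?I (Q \<union> {(x, y, b) |y b. y < Suc k \<and> b < n}) (lists n (snd (sem w ?c3 t)))"
      by simp
  qed (use s' in auto)
  let ?c2 = "stride 9 10 1 ?c3"
  show ?thesis unfolding sweep_def
  proof (rule stride_rule[where
        P = "\<lambda>k t. ?I {(x, y, b) |x y b. x < k \<and> y < n \<and> b < n} (lists n (snd t))"])
    fix k and t :: store
    assume k: "k < n" "fst t 7 = k" "fst t 8 = k * n"
      and frame: "\<And>v. v \<notin> assigned ?c2 \<Longrightarrow> v \<noteq> 7 \<Longrightarrow> v \<noteq> 8 \<Longrightarrow> fst t v = fst s v"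
      and P: "?I {(x, y, b) |x y b. x < k \<and> y < n \<and> b < n} (lists n (snd t))"
    have "?I ({(x, y, b) |x y b. x < k \<and> y < n \<and> b < n} \<union> {(k, y, b) |y b. y < n \<and> b < n})
        (lists n (snd (sem w ?c2 t)))"
      by (rule 2) (use s k frame P in auto)
    moreover have "{(x, y, b) |x y b. x < Suc k \<and> y < n \<and> b < n} =
        {(x, y, b) |x y b. x < k \<and> y < n \<and> b < n} \<union> {(k, y, b) |y b. y < n \<and> b < n}"
      by (auto simp: less_Suc_eq)
    ultimately show "?I {(x, y, b) |x y b. x < Suc k \<and> y < n \<and> b < n} (lists n (snd (sem w ?c2 t)))"
      by simp
  qed (use s in \<open>auto simp: S_def sweep_inv_def\<close>)
qed

lemma sweeps_correct:
  assumes s: "fst s 1 = n" "fst s 2 = n * n"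
  defines "S\<^sub>0 \<equiv> lists n (snd s)" and "S \<equiv> lists n (snd (sem w (For 17 2 sweep) s))"
  shows "p \<in> S \<longleftrightarrow> (\<exists>C. arc_consistent (adj w n) n C \<and> C \<subseteq> S\<^sub>0 \<and> p \<in> C)"
proof -
  have "sweeps_inv (adj w n) n S\<^sub>0 (n * n) (lists n (snd (sem w (For 17 2 sweep) s)))"
  proof (rule For_rule[where P = "\<lambda>k t. sweeps_inv (adj w n) n S\<^sub>0 k (lists n (snd t))"])
    show "sweeps_inv (adj w n) n S\<^sub>0 0 (lists n (snd (setv 17 0 s)))"
      unfolding S\<^sub>0_def snd_setv by (rule sweeps_inv_0[OF lists_subset])
    fix k and t :: store
    assume P: "sweeps_inv (adj w n) n S\<^sub>0 k (lists n (snd t))"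
      and frame: "\<And>v. v \<notin> assigned sweep \<Longrightarrow> v \<noteq> 17 \<Longrightarrow> fst t v = fst s v"
    have "fst t 1 = n" using frame[of 1] s by simp
    then show "sweeps_inv (adj w n) n S\<^sub>0 (Suc k) (lists n (snd (setv 17 (Suc k) (sem w sweep t))))"
      unfolding snd_setv by (intro sweeps_inv_Suc[OF P lists_subset] sweep_correct)
  qed (use s in simp_all)
  then show ?thesis
    unfolding S_def by (intro sweeps_inv_done lists_subset)
qed

lemma init_lists_correct:
  assumes s: "fst s 1 = n" "fst s 3 = u" "fst s 5 = v" "fst s 6 = a"
  shows "lists n (snd (sem w init_lists s)) = identifying n u v a"
proof -
  let ?good = "\<lambda>x b. x = u \<or> x = v \<longrightarrow> b = a"
  let ?e = "Plus (Minus (Num 1) (Plus (Minus (Num 1) (distance 7 3)) (Minus (Num 1) (distance 7 5))))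
       (Minus (Num 1) (distance 11 6))"
  let ?c = "Put (Plus (Var 8) (Var 11)) ?e"
  \<comment> \<open>Lexicographic progress: the rows below \<open>k\<close> and the first
    \<open>l\<close> entries of row \<open>k\<close> are written. A complete row \<open>k\<close> is
    the same as an unstarted row \<open>Suc k\<close>.\<close>
  let ?P = "\<lambda>k l t. \<forall>x b. b < n \<longrightarrow> x < k \<or> x = k \<and> b < l \<longrightarrow>
    (snd t (x * n + b) \<noteq> 0 \<longleftrightarrow> ?good x b)"
  have "?P n 0 (sem w init_lists s)"
    unfolding init_lists_def
  proof (rule stride_rule[where P = "\<lambda>k t. ?P k 0 t"])
    fix k and t :: store
    assume k: "k < n" "fst t 7 = k" "fst t 8 = k * n" and P: "?P k 0 t"
      and frame: "\<And>v. v \<notin> assigned (For 11 1 ?c) \<Longrightarrow> v \<noteq> 7 \<Longrightarrow> v \<noteq> 8 \<Longrightarrow> fst t v = fst s v"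
    have "?P k n (sem w (For 11 1 ?c) t)"
    proof (rule For_rule[where P = "\<lambda>l t. ?P k l t"])
      show "fst t 1 = n" using frame s by simp
      fix l and t' :: store
      assume l: "l < n" "fst t' 11 = l" and P: "?P k l t'"
        and frame': "\<And>v. v \<notin> assigned ?c \<Longrightarrow> v \<noteq> 11 \<Longrightarrow> fst t' v = fst t v"
      have t': "fst t' 3 = u" "fst t' 5 = v" "fst t' 6 = a" "fst t' 7 = k" "fst t' 8 = k * n"
        using frame frame' s k by simp_all
      have e: "aval w ?e t' \<noteq> 0 \<longleftrightarrow> ?good k l"
        by (auto simp: distance_def t' l)
      have mem: "snd (sem w ?c t') = (snd t')(k * n + l := aval w ?e t')"
        by (simp add: t' l)
      show "?P k (Suc l) (setv 11 (Suc l) (sem w ?c t'))"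
      proof (intro allI impI)
        fix x b assume b: "b < n" and xb: "x < k \<or> x = k \<and> b < Suc l"
        show "snd (setv 11 (Suc l) (sem w ?c t')) (x * n + b) \<noteq> 0 \<longleftrightarrow> ?good x b"
        proof (cases "x = k \<and> b = l")
          case True
          then show ?thesis using e by (simp only: mem snd_setv fun_upd_same)
        next
          case False
          then have "x < k \<or> x = k \<and> b < l" using xb by auto
          with P b have "snd t' (x * n + b) \<noteq> 0 \<longleftrightarrow> ?good x b" by blast
          moreover have "x * n + b \<noteq> k * n + l" using False index_inj[OF b l(1)] by blast
          ultimately show ?thesis unfolding mem snd_setv by (simp del: aval.simps)
        qed
      qed
    qed (use P in auto)
    then show "?P (Suc k) 0 (sem w (For 11 1 ?c) t)"
      by (auto simp: less_Suc_eq)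
  qed (use s in auto)
  then show ?thesis by (auto simp: lists_def identifying_def)
qed

lemma attempt_correct:
  assumes s: "fst s 1 = n" "fst s 2 = n * n" "fst s 3 = u" "fst s 4 = u * n" "fst s 5 = v" "fst s 6 = a"
    and "u < n" "a < n"
  shows "fst (sem w attempt s) 16 \<noteq> 0 \<longleftrightarrow> fst s 16 \<noteq> 0 \<or> foldable (adj w n) n u v a"
proof -
  let ?s1 = "sem w init_lists s"
  let ?s2 = "sem w (For 17 2 sweep) ?s1"
  have frame: "fst ?s2 i = fst s i" if "i \<in> {3, 4, 5, 6, 16}" for i
    using that by (auto simp: sem_frame simp del: sem.simps)
  have eq: "fst ?s2 3 = u" "fst ?s2 4 = u * n" "fst ?s2 5 = v" "fst ?s2 6 = a" "fst ?s2 16 = fst s 16"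
    using s by (simp_all add: frame del: sem.simps)
  have "(u, a) \<in> lists n (snd ?s2) \<longleftrightarrow> (\<exists>C. arc_consistent (adj w n) n C \<and>
      C \<subseteq> identifying n u v a \<and> (u, a) \<in> C)"
    using sweeps_correct[of ?s1 "(u, a)"] init_lists_correct[of s u v a] s
    by (simp add: sem_frame del: sem.simps)
  then have "snd ?s2 (u * n + a) \<noteq> 0 \<and> u \<noteq> v \<longleftrightarrow> foldable (adj w n) n u v a"
    using assms(7,8) by (auto simp: lists_def foldable_def)
  moreover have "fst (sem w attempt s) 16 = fst ?s2 16 +
      (1 - ((1 - snd ?s2 (fst ?s2 4 + fst ?s2 6)) + (1 - aval w (distance 3 5) ?s2)))"
    by (simp add: attempt_def del: sem.simps(4))
  moreover have "aval w (distance 3 5) ?s2 = (u - v) + (v - u)"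
    by (simp add: distance_def eq del: sem.simps)
  ultimately show ?thesis by (auto simp: eq simp del: sem.simps)
qed

text \<open>After a loop, variable 16 is nonzero iff it was before or the loop met a fold; nested
  loops thus give nested existential quantifiers.\<close>

lemma find_fold_correct:
  assumes s: "fst s 1 = n" "fst s 2 = n * n"
  shows "fst (sem w find_fold s) 0 =
    (if \<exists>u<n. \<exists>v<n. \<exists>a<n. foldable (adj w n) n u v a then 0 else 1)"
proof -
  let ?F = "foldable (adj w n) n"
  have 3: "fst (sem w (For 6 1 attempt) t) 16 \<noteq> 0 \<longleftrightarrow> fst t 16 \<noteq> 0 \<or> (\<exists>a<n. ?F u v a)"
    if t: "fst t 1 = n" "fst t 2 = n * n" "fst t 3 = u" "fst t 4 = u * n" "fst t 5 = v" "u < n" for t u v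
  proof (rule For_rule[where P = "\<lambda>k t'. fst t' 16 \<noteq> 0 \<longleftrightarrow> fst t 16 \<noteq> 0 \<or> (\<exists>a<k. ?F u v a)"])
    fix k and t' :: store
    assume k: "k < n" "fst t' 6 = k" and P: "fst t' 16 \<noteq> 0 \<longleftrightarrow> fst t 16 \<noteq> 0 \<or> (\<exists>a<k. ?F u v a)"
      and frame: "\<And>v. v \<notin> assigned attempt \<Longrightarrow> v \<noteq> 6 \<Longrightarrow> fst t' v = fst t v"
    have "fst (sem w attempt t') 16 \<noteq> 0 \<longleftrightarrow> fst t' 16 \<noteq> 0 \<or> ?F u v k"
      by (rule attempt_correct) (use t k frame in auto)
    then show "fst (setv 6 (Suc k) (sem w attempt t')) 16 \<noteq> 0 \<longleftrightarrow>
        fst t 16 \<noteq> 0 \<or> (\<exists>a<Suc k. ?F u v a)"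
      using P by (auto simp: Ex_less_Suc)
  qed (use t in auto)
  let ?c3 = "For 6 1 attempt"
  have 2: "fst (sem w (For 5 1 ?c3) t) 16 \<noteq> 0 \<longleftrightarrow> fst t 16 \<noteq> 0 \<or> (\<exists>v<n. \<exists>a<n. ?F u v a)"
    if t: "fst t 1 = n" "fst t 2 = n * n" "fst t 3 = u" "fst t 4 = u * n" "u < n" for t u
  proof (rule For_rule[where P = "\<lambda>k t'. fst t' 16 \<noteq> 0 \<longleftrightarrow> fst t 16 \<noteq> 0 \<or> (\<exists>v<k. \<exists>a<n. ?F u v a)"])
    fix k and t' :: store
    assume k: "k < n" "fst t' 5 = k"
      and P: "fst t' 16 \<noteq> 0 \<longleftrightarrow> fst t 16 \<noteq> 0 \<or> (\<exists>v<k. \<exists>a<n. ?F u v a)"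
      and frame: "\<And>v. v \<notin> assigned ?c3 \<Longrightarrow> v \<noteq> 5 \<Longrightarrow> fst t' v = fst t v"
    have "fst (sem w ?c3 t') 16 \<noteq> 0 \<longleftrightarrow> fst t' 16 \<noteq> 0 \<or> (\<exists>a<n. ?F u k a)"
      by (rule 3) (use t k frame in auto)
    then show "fst (setv 5 (Suc k) (sem w ?c3 t')) 16 \<noteq> 0 \<longleftrightarrow>
        fst t 16 \<noteq> 0 \<or> (\<exists>v<Suc k. \<exists>a<n. ?F u v a)"
      using P by (auto simp: Ex_less_Suc simp del: sem.simps)
  qed (use t in auto)
  let ?c2 = "For 5 1 ?c3"
  have "fst (sem w (stride 3 4 1 ?c2) (setv 16 0 s)) 16 \<noteq> 0 \<longleftrightarrow> (\<exists>u<n. \<exists>v<n. \<exists>a<n. ?F u v a)"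
  proof (rule stride_rule[where P = "\<lambda>k t. fst t 16 \<noteq> 0 \<longleftrightarrow> (\<exists>u<k. \<exists>v<n. \<exists>a<n. ?F u v a)"])
    fix k and t :: store
    assume k: "k < n" "fst t 3 = k" "fst t 4 = k * n"
      and P: "fst t 16 \<noteq> 0 \<longleftrightarrow> (\<exists>u<k. \<exists>v<n. \<exists>a<n. ?F u v a)"
      and frame: "\<And>v. v \<notin> assigned ?c2 \<Longrightarrow> v \<noteq> 3 \<Longrightarrow> v \<noteq> 4 \<Longrightarrow> fst t v = fst (setv 16 0 s) v"
    have "fst (sem w ?c2 t) 16 \<noteq> 0 \<longleftrightarrow> fst t 16 \<noteq> 0 \<or> (\<exists>v<n. \<exists>a<n. ?F k v a)"
      by (rule 2) (use s k frame in auto)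
    then show "fst (sem w ?c2 t) 16 \<noteq> 0 \<longleftrightarrow> (\<exists>u<Suc k. \<exists>v<n. \<exists>a<n. ?F u v a)"
      using P by (auto simp: Ex_less_Suc simp del: sem.simps)
  qed (use s in auto)
  then show ?thesis
    by (cases "\<exists>u<n. \<exists>v<n. \<exists>a<n. ?F u v a") (simp_all add: find_fold_def Suc_le_eq del: sem.simps(4))
qed

end


section \<open>Homomorphisms from trees\<close>

text \<open>Zipping a vertex list with its tail gives the arcs of the walk through it; this turns
  paths given by vertices into library walks.\<close>

lemma walk_of_vertex_list:
  assumes "successively (\<lambda>x y. (x, y) \<in> E) (x # vs)"
  shows "pcas x (zip (x # vs) vs) (last (x # vs))" "set (zip (x # vs) vs) \<subseteq> E"
    "pawalk_verts x (zip (x # vs) vs) = x # vs"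
  using assms by (induction vs arbitrary: x) auto

text \<open>Longest path argument: otherwise the first vertex \<open>x\<close> of a longest path in
  \<open>W\<close> has a neighbour \<open>y\<close> in \<open>W\<close> other than its successor. By
  maximality \<open>y\<close> lies on the path, which closes a cycle.\<close>

lemma undirected_tree_vertex_of_degree_le_1:
  assumes G: "undirected_tree G" and W: "W \<subseteq> pverts G" "W \<noteq> {}"
  shows "\<exists>z\<in>W. \<exists>z'. \<forall>y\<in>W. (z, y) \<in> parcs G \<longrightarrow> y = z'"
proof (rule ccontr)
  assume "\<not> ?thesis"
  then have two: "\<exists>y\<in>W. (z, y) \<in> parcs G \<and> y \<noteq> z'" if "z \<in> W" for z z'
    using that by blast
  interpret pair_graph G
    using G by (simp add: undirected_tree_def)
  define path where "path p \<longleftrightarrow> p \<noteq> [] \<and> distinct p \<and> set p \<subseteq> W \<and>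
    successively (\<lambda>x y. (x, y) \<in> parcs G) p" for p
  have "finite W"
    using W pair_finite_verts finite_subset by blast
  then have "length p \<le> card W" if "path p" for p
    using that by (metis path_def distinct_card card_mono)
  moreover obtain x\<^sub>0 where "x\<^sub>0 \<in> W" using W by blast
  then have "path [x\<^sub>0]" by (simp add: path_def)
  ultimately obtain p where p: "path p" and longest: "\<And>q. path q \<Longrightarrow> length q \<le> length p"
    using ex_has_greatest_nat[of path "[x\<^sub>0]" length "Suc (card W)"] by (metis le_imp_less_Suc)
  obtain x q where xq: "p = x # q" using p by (cases p) (auto simp: path_def)
  have "x \<in> W" using p xq by (simp add: path_def)
  \<comment> \<open>If \<open>q\<close> is empty, \<open>hd q\<close> is an arbitrary value; any
    neighbour \<open>y\<close> then makes the path longer.\<close>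
  then obtain y where y: "y \<in> W" "(x, y) \<in> parcs G" "y \<noteq> hd q"
    using two by blast
  have "(y, x) \<in> parcs G"
    using y(2) pair_sym_arcs by (simp add: symmetric_def symD)
  have "y \<in> set q"
  proof (rule ccontr)
    assume "y \<notin> set q"
    moreover have "y \<noteq> x" using pair_no_loops[OF y(2)] by simp
    ultimately have "path (y # p)"
      using p xq y(1) \<open>(y, x) \<in> parcs G\<close> by (simp add: path_def)
    from longest[OF this] show False by simp
  qed
  then obtain q\<^sub>1 q\<^sub>2 where q: "q = q\<^sub>1 @ y # q\<^sub>2" by (meson split_list)
  \<comment> \<open>As \<open>y\<close> is not the successor of \<open>x\<close>, the closed walk
    from \<open>x\<close> through \<open>q\<^sub>1\<close> and \<open>y\<close> back to
    \<open>x\<close> has at least 3 arcs.\<close>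
  have "q\<^sub>1 \<noteq> []" using q y(3) by auto
  let ?vs = "q\<^sub>1 @ [y, x]"
  have "successively (\<lambda>x y. (x, y) \<in> parcs G) (x # ?vs)"
    using p \<open>(y, x) \<in> parcs G\<close> \<open>q\<^sub>1 \<noteq> []\<close>
    by (auto simp: path_def xq q successively_append_iff successively_Cons)
  from walk_of_vertex_list[OF this]
  have "pre_digraph.cycle (with_proj G) (zip (x # ?vs) ?vs)"
    using p xq q \<open>x \<in> W\<close> W(1) by (auto simp: cycle_def awalk_def path_def)
  moreover have "3 \<le> length (zip (x # ?vs) ?vs)"
    using \<open>q\<^sub>1 \<noteq> []\<close> by (cases q\<^sub>1) auto
  ultimately show False
    using G unfolding undirected_tree_def by blast
qed

text \<open>Induction on \<open>W\<close>: remove a vertex \<open>z\<close> with at most one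
  neighbour \<open>z'\<close> in \<open>W\<close>, map the rest, and choose an image of
  \<open>z\<close> that fits the image of \<open>z'\<close>.\<close>

lemma hom_from_tree:
  assumes G: "undirected_tree G" and T: "orientation_of T G"
    and nonempty: "\<And>x. x \<in> pverts G \<Longrightarrow> L x \<noteq> {}"
    and consistent: "\<And>x y b. x \<in> pverts G \<Longrightarrow> y \<in> pverts G \<Longrightarrow> b \<in> L x \<Longrightarrow>
      \<exists>c\<in>L y. ((x, y) \<in> parcs T \<longrightarrow> (b, c) \<in> parcs H) \<and> ((y, x) \<in> parcs T \<longrightarrow> (c, b) \<in> parcs H)"
    and W: "W \<subseteq> pverts G"
  shows "\<exists>h. (\<forall>x\<in>W. h x \<in> L x) \<and>
    (\<forall>x\<in>W. \<forall>y\<in>W. (x, y) \<in> parcs T \<longrightarrow> (h x, h y) \<in> parcs H)"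
proof -
  interpret pair_graph G
    using G by (simp add: undirected_tree_def)
  have "finite W"
    using W pair_finite_verts finite_subset by blast
  then show ?thesis
    using W
  proof (induction W rule: finite_psubset_induct)
    case (psubset W)
    show ?case
    proof (cases "W = {}")
      case False
      with undirected_tree_vertex_of_degree_le_1[OF G psubset.prems] obtain z z' where
        z: "z \<in> W" and z': "\<And>y. y \<in> W \<Longrightarrow> (z, y) \<in> parcs G \<Longrightarrow> y = z'" by blast
      let ?W = "W - {z}"
      obtain h where h: "\<And>x. x \<in> ?W \<Longrightarrow> h x \<in> L x"
        "\<And>x y. x \<in> ?W \<Longrightarrow> y \<in> ?W \<Longrightarrow> (x, y) \<in> parcs T \<Longrightarrow> (h x, h y) \<in> parcs H"
        using psubset.IH[of ?W] psubset.prems z by blast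
      \<comment> \<open>Consistency is used from \<open>z'\<close> towards \<open>z\<close>; if
        \<open>z'\<close> is not in \<open>?W\<close>, any element of \<open>L z\<close> will
        do.\<close>
      obtain c where c: "c \<in> L z" "z' \<in> ?W \<Longrightarrow>
          ((z', z) \<in> parcs T \<longrightarrow> (h z', c) \<in> parcs H) \<and> ((z, z') \<in> parcs T \<longrightarrow> (c, h z') \<in> parcs H)"
        using consistent[of z' z "h z'"] nonempty[of z] h(1) psubset.prems z by blast
      have arcs: "(x, y) \<in> parcs G" "(y, x) \<in> parcs G" if "(x, y) \<in> parcs T" for x y
        using that T pair_sym_arcs by (auto simp: orientation_of_def symmetric_def symD)
      have "(z, z) \<notin> parcs T" using arcs(1) pair_no_loops by fastforce
      have "((h(z := c)) x, (h(z := c)) y) \<in> parcs H"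
        if xy: "x \<in> W" "y \<in> W" "(x, y) \<in> parcs T" for x y
      proof -
        consider "x = z" "y \<in> ?W" | "y = z" "x \<in> ?W" | "x \<in> ?W" "y \<in> ?W"
          using xy \<open>(z, z) \<notin> parcs T\<close> by blast
        then show ?thesis
        proof cases
          case 1
          then have "y = z'" using z' arcs[OF xy(3)] by blast
          with 1 show ?thesis using c(2) xy(3) by auto
        next
          case 2
          then have "x = z'" using z' arcs[OF xy(3)] by blast
          with 2 show ?thesis using c(2) xy(3) by auto
        next
          case 3
          then show ?thesis using h(2) xy(3) by auto
        qed
      qed
      moreover have "(h(z := c)) x \<in> L x" if "x \<in> W" for x
        using that h(1) c(1) by auto
      ultimately show ?thesis by blast
    qed auto
  qed
qed

text \<open>A fold yields, by \<open>hom_from_tree\<close>, an endomorphism identifying two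
  vertices. Conversely, the graph of a non-injective endomorphism is itself an arc consistent
  set.\<close>

lemma is_core_iff_not_foldable:
  assumes T: "oriented_tree T" and vs: "distinct vs" "set vs = pverts T" and n: "n = length vs"
    and E: "\<And>i j. i < n \<Longrightarrow> j < n \<Longrightarrow> E i j \<longleftrightarrow> (vs ! i, vs ! j) \<in> parcs T"
  shows "is_core T \<longleftrightarrow> \<not> (\<exists>u<n. \<exists>v<n. \<exists>a<n. foldable E n u v a)"
proof -
  obtain G where G: "undirected_tree G" "orientation_of T G"
    using T by (auto simp: oriented_tree_def)
  have verts: "pverts T = pverts G" and arcs: "parcs T \<subseteq> parcs G"
    using G(2) by (auto simp: orientation_of_def)
  have "pair_wf_digraph G"
    using G(1) by (simp add: undirected_tree_def pair_graph_def pair_digraph_def pair_fin_digraph_def)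
  note arc_verts = pair_wf_digraph.in_arcsD1[OF this] pair_wf_digraph.in_arcsD2[OF this]
  have index: "\<exists>i<n. x = vs ! i" if "x \<in> pverts T" for x
    using that vs(2) n by (metis in_set_conv_nth)
  have nth: "vs ! i \<in> pverts T" if "i < n" for i
    using nth_mem[of i vs] that vs(2) n by simp
  have inj: "vs ! i = vs ! j \<longleftrightarrow> i = j" if "i < n" "j < n" for i j
    using that vs(1) n by (simp add: nth_eq_iff_index_eq)
  show ?thesis
  proof
    assume core: "is_core T"
    show "\<not> (\<exists>u<n. \<exists>v<n. \<exists>a<n. foldable E n u v a)"
    proof
      assume "\<exists>u<n. \<exists>v<n. \<exists>a<n. foldable E n u v a"
      then obtain u v a C where uv: "u < n" "v < n" "a < n" "u \<noteq> v" and C: "arc_consistent E n C"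
        "C \<subseteq> identifying n u v a" "(u, a) \<in> C"
        by (auto simp: foldable_def)
      have lt: "i < n \<and> b < n" if "(i, b) \<in> C" for i b
        using that C(2) by (auto simp: identifying_def)
      have supp: "\<exists>c<n. (j, c) \<in> C \<and> (E i j \<longrightarrow> E b c) \<and> (E j i \<longrightarrow> E c b)"
        if "(i, b) \<in> C" "j < n" for i b j
        using C(1)[unfolded arc_consistent_def, rule_format, OF that(1)] that(2)
        by (simp add: supported_def)
      \<comment> \<open>The lists \<open>C\<close>, carried over from positions in \<open>vs\<close>
        to vertices.\<close>
      define L where "L x = {vs ! b |i b. (i, b) \<in> C \<and> x = vs ! i}" for x
      have "\<exists>h. (\<forall>x\<in>pverts G. h x \<in> L x) \<and>
        (\<forall>x\<in>pverts G. \<forall>y\<in>pverts G. (x, y) \<in> parcs T \<longrightarrow> (h x, h y) \<in> parcs T)"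
      proof (rule hom_from_tree[OF G])
        fix x assume "x \<in> pverts G"
        then obtain i where "i < n" "x = vs ! i" using index verts by auto
        then show "L x \<noteq> {}" using supp[OF C(3), of i] unfolding L_def by blast
      next
        fix x y b assume x: "x \<in> pverts G" "y \<in> pverts G" "b \<in> L x"
        then obtain i b' where i: "(i, b') \<in> C" "x = vs ! i" "b = vs ! b'" by (auto simp: L_def)
        obtain j where j: "j < n" "y = vs ! j" using index x(2) verts by auto
        obtain c where c: "c < n" "(j, c) \<in> C" "E i j \<longrightarrow> E b' c" "E j i \<longrightarrow> E c b'"
          using supp[OF i(1) j(1)] by blast
        show "\<exists>c\<in>L y. ((x, y) \<in> parcs T \<longrightarrow> (b, c) \<in> parcs T) \<and> ((y, x) \<in> parcs T \<longrightarrow> (c, b) \<in> parcs T)"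
        proof
          show "vs ! c \<in> L y" unfolding L_def using c(2) j(2) by blast
          show "((x, y) \<in> parcs T \<longrightarrow> (b, vs ! c) \<in> parcs T) \<and> ((y, x) \<in> parcs T \<longrightarrow> (vs ! c, b) \<in> parcs T)"
            using c(1,3,4) i j lt[OF i(1)] by (simp add: E)
        qed
      qed auto
      then obtain h where h: "\<And>x. x \<in> pverts G \<Longrightarrow> h x \<in> L x"
        "\<And>x y. x \<in> pverts G \<Longrightarrow> y \<in> pverts G \<Longrightarrow> (x, y) \<in> parcs T \<Longrightarrow> (h x, h y) \<in> parcs T"
        by blast
      have "L x \<subseteq> pverts T" for x
        using lt nth by (auto simp: L_def)
      then have "\<forall>x\<in>pverts T. h x \<in> pverts T"
        using h(1) verts by blast
      moreover have "(h x, h y) \<in> parcs T" if "(x, y) \<in> parcs T" for x y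
        using that arcs arc_verts by (intro h(2)) blast+
      ultimately have "digraph_hom T T h"
        by (simp add: digraph_hom_def)
      then have "inj_on h (pverts T)" using core by (simp add: is_core_def)
      \<comment> \<open>By the choice of \<open>C\<close>, the lists of \<open>vs ! u\<close> and
        \<open>vs ! v\<close> have no element but \<open>vs ! a\<close>; distinctness of
        \<open>vs\<close> recovers the position from the vertex.\<close>
      have "h (vs ! i) = vs ! a" if "i = u \<or> i = v" for i
      proof -
        have "i < n" using that uv by blast
        with h(1) nth verts have "h (vs ! i) \<in> L (vs ! i)" by simp
        then obtain i' b where i': "(i', b) \<in> C" "h (vs ! i) = vs ! b" "vs ! i = vs ! i'"
          by (auto simp: L_def)
        then have "i = i'" using inj[of i i'] lt[of i' b] \<open>i < n\<close> by simp
        with i'(1) have "(i, b) \<in> identifying n u v a" using C(2) by blast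
        then have "b = a" using that by (auto simp: identifying_def)
        with i'(2) show ?thesis by simp
      qed
      from this[of u] this[of v] have "h (vs ! u) = h (vs ! v)"
        by simp
      from inj_onD[OF \<open>inj_on h (pverts T)\<close> this nth[OF uv(1)] nth[OF uv(2)]] show False
        using inj[OF uv(1,2)] uv(4) by simp
    qed
  next
    assume not_foldable: "\<not> (\<exists>u<n. \<exists>v<n. \<exists>a<n. foldable E n u v a)"
    show "is_core T"
      unfolding is_core_def
    proof (intro allI impI, rule ccontr)
      fix h assume h: "digraph_hom T T h" and "\<not> inj_on h (pverts T)"
      then obtain x y where xy: "x \<in> pverts T" "y \<in> pverts T" "x \<noteq> y" "h x = h y"
        by (auto simp: inj_on_def)
      have "\<forall>i\<in>{..<n}. \<exists>b. b < n \<and> h (vs ! i) = vs ! b"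
        using h nth index unfolding digraph_hom_def by blast
      from bchoice[OF this] obtain g where g: "\<And>i. i < n \<Longrightarrow> g i < n \<and> h (vs ! i) = vs ! g i"
        by auto
      obtain u v where uv: "u < n" "x = vs ! u" "v < n" "y = vs ! v"
        using index[OF xy(1)] index[OF xy(2)] by blast
      have "vs ! g u = vs ! g v" using g[OF uv(1)] g[OF uv(3)] uv xy(4) by simp
      then have "g u = g v" using g uv inj by simp
      \<comment> \<open>The graph of the endomorphism in terms of positions; the image
        \<open>g j\<close> is the support that \<open>g i\<close> finds at \<open>j\<close>.\<close>
      define C where "C = {(i, b). i < n \<and> b = g i}"
      have E_g: "E (g i) (g j)" if "i < n" "j < n" "E i j" for i j
      proof -
        have "(h (vs ! i), h (vs ! j)) \<in> parcs T"
          using h E[OF that(1,2)] that(3) by (simp add: digraph_hom_def)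
        then show ?thesis using E g that(1,2) by simp
      qed
      have "supported E n C i j (g i)" if "i < n" "j < n" for i j
        unfolding supported_def using that g[OF that(2)] E_g
        by (intro exI[of _ "g j"]) (simp add: C_def)
      then have "arc_consistent E n C"
        by (simp add: arc_consistent_def C_def)
      moreover have "C \<subseteq> identifying n u v (g u)"
      proof
        fix p assume "p \<in> C"
        then obtain i where i: "p = (i, g i)" "i < n" by (auto simp: C_def)
        show "p \<in> identifying n u v (g u)"
          using g[OF i(2)] i \<open>g u = g v\<close> by (auto simp: identifying_def)
      qed
      moreover have "(u, g u) \<in> C" using uv by (simp add: C_def)
      moreover have "u \<noteq> v" using uv xy by blast
      ultimately have "foldable E n u v (g u)"
        unfolding foldable_def by (intro conjI exI[of _ C])
      then show False using not_foldable uv g by blast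
    qed
  qed
qed

section \<open>The adjacency matrix as a word, and the decision procedure\<close>

lemma nth_row_by_row:
  assumes "i < length us" "j < length vs"
  shows "concat (map (\<lambda>u. map (f u) vs) us) ! (i * length vs + j) = f (us ! i) (vs ! j)"
    "i * length vs + j < length us * length vs"
  using assms
proof (induction us arbitrary: i)
  case (Cons u us)
  {
    case 1
    then show ?case using Cons by (cases i) (auto simp: nth_append)
  next
    case 2
    then show ?case using Cons by (cases i) auto
  }
qed auto

lemma length_row_by_row: "length (concat (map (\<lambda>u. map (f u) vs) us)) = length us * length vs"
  by (induction us) auto

theorem corollary3:
  shows "poly_time_decidable adjacency_encoding
           {T :: nat pair_pre_digraph. oriented_tree T} is_core"
proof (rule poly_time_decidableI[where c = square_root and d = find_fold and D = 20 and K = 40])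
  \<comment> \<open>The program uses the variables 0 to 19; the registers 20 to 39 are enough for
    the evaluation stack.\<close>
  show "well_formed 20 40 square_root"
    by (simp add: square_root_def)
  show "well_formed 20 40 find_fold"
    by (simp add: find_fold_def attempt_def init_lists_def sweep_def revise_def search_def
        stride_def distance_def)
next
  fix T :: "nat pair_pre_digraph" and w v
  assume "v \<in> bounds square_root"
  then show "v \<notin> assigned square_root \<and> fst (initial_store w) v \<le> length w"
    by (auto simp: square_root_def initial_store_def)
next
  fix T :: "nat pair_pre_digraph" and w
  assume T: "T \<in> {T. oriented_tree T}" and enc: "adjacency_encoding T w"
  then obtain vs where vs: "distinct vs" "set vs = pverts T"
    and w: "w = concat (map (\<lambda>u. map (\<lambda>v. (u, v) \<in> parcs T) vs) vs)"
    by (auto simp: adjacency_encoding_def)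
  define n where "n = length vs"
  have len: "length w = n * n"
    by (simp add: w n_def length_row_by_row)
  have E: "adj w n i j \<longleftrightarrow> (vs ! i, vs ! j) \<in> parcs T" if "i < n" "j < n" for i j
    using that nth_row_by_row(1)[of i vs j vs "\<lambda>u v. (u, v) \<in> parcs T"]
      nth_row_by_row(2)[of i vs j vs] len
    by (auto simp: adj_def w n_def)
  let ?s = "sem w square_root (initial_store w)"
  have s: "fst ?s 1 = n" "fst ?s 2 = n * n"
    using square_root_correct[of "initial_store w" n w] len by (auto simp: initial_store_def)
  show "fst (sem w find_fold ?s) 0 = (if is_core T then 1 else 0)"
    using find_fold_correct[OF s] is_core_iff_not_foldable[OF _ vs n_def E] T by auto
  fix v
  \<comment> \<open>The loop bounds are \<open>n\<close> and \<open>n * n\<close>, both at most the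
    input length \<open>n * n\<close>.\<close>
  assume "v \<in> bounds find_fold"
  then have "v = 1 \<or> v = 2"
    by (auto simp: find_fold_def attempt_def init_lists_def sweep_def revise_def search_def)
  then show "v \<notin> assigned find_fold \<and> fst ?s v \<le> length w"
    using s len by (auto simp: find_fold_def)
qed auto

end
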